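(* Let $V:\mathbb{C}^n\to\mathbb{C}^n$ be a complete holomorphic vector field for which the origin is a globally asymptotically stable fixed point, and let $A=DV(0)$. Let $X_t$ denote the flow of $V$, and write $V(z)=Az+R(z)$, where $R(z)=o(\|z\|)$ as $z\to 0$. Suppose that, for every compact set $K\subset\mathbb{C}^n$, the improper integral $$\int_0^\infty e^{-sA}R(X_s(z))\,ds$$ converges uniformly for $z\in K$. Then the limit $$F(z):=\lim_{t\to\infty}e^{-tA}X_t(z)$$ exists locally uniformly on $\mathbb{C}^n$, and $F\in\operatorname{Aut}(\mathbb{C}^n)$. Moreover, $$F\circ X_t\circ F^{-1}=e^{tA}\qquad\text{for all } t\in\mathbb{C}.$$
   Context: A holomorphic vector field on $\mathbb{C}^n$ is identified with a holomorphic map $V:\mathbb{C}^n\to\mathbb{C}^n$; its flow $X_t$ solves $\frac{d}{dt}X_t(z)=V(X_t(z))$, $X_0(z)=z$. Complete means that the flow is defined for all complex times $t\in\mathbb{C}$; its restriction to $t\in\mathbb{R}$ is the real-time flow. The limit and the improper integral are taken over real times. The origin is a globally asymptotically stable fixed point if $V(0)=0$, the origin is Lyapunov stable for the real-time flow (for every $r>0$ there is $\delta>0$ with $\|X_t(z)\|<r$ for all $\|z\|<\delta$ and $t\ge 0$), and $X_t(z)\to 0$ as $t\to+\infty$ for every $z\in\mathbb{C}^n$. $\operatorname{Aut}(\mathbb{C}^n)$ is the group of biholomorphic maps $\mathbb{C}^n\to\mathbb{C}^n$. *)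

theory Defs
  imports "HOL-Analysis.Analysis" "HOL-Library.Landau_Symbols"
begin

text \<open>The space of \<open>n\<close>-tuples of complex numbers is \<open>complex ^ 'n\<close> with its Euclidean norm.  A map is
  holomorphic if at every point its Frechet derivative exists and is complex linear, i.e. is given
  by a complex matrix.\<close>

definition holomorphic_map :: "(complex ^ 'n \<Rightarrow> complex ^ 'n) \<Rightarrow> bool" where
  "holomorphic_map f \<longleftrightarrow>
     (\<forall>z. \<exists>D :: complex ^ 'n ^ 'n. (f has_derivative (\<lambda>h. D *v h)) (at z))"

definition Aut :: "(complex ^ 'n \<Rightarrow> complex ^ 'n) set" where
  "Aut = {F. bij F \<and> holomorphic_map F \<and> holomorphic_map (inv F)}"

text \<open>The differential equation is in complex time: the time derivative is a complex one.\<close>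

definition is_complex_flow ::
    "(complex ^ 'n \<Rightarrow> complex ^ 'n) \<Rightarrow> (complex \<Rightarrow> complex ^ 'n \<Rightarrow> complex ^ 'n) \<Rightarrow> bool" where
  "is_complex_flow V X \<longleftrightarrow>
     (\<forall>z. X 0 z = z) \<and>
     (\<forall>z t. ((\<lambda>s. X s z) has_derivative (\<lambda>h. h *s V (X t z))) (at t))"

definition complete_field :: "(complex ^ 'n \<Rightarrow> complex ^ 'n) \<Rightarrow> bool" where
  "complete_field V \<longleftrightarrow> (\<exists>X. is_complex_flow V X)"

definition lyapunov_stable_origin :: "(complex \<Rightarrow> complex ^ 'n \<Rightarrow> complex ^ 'n) \<Rightarrow> bool" where
  "lyapunov_stable_origin X \<longleftrightarrow>
     (\<forall>r>0. \<exists>\<delta>>0. \<forall>z. norm z < \<delta> \<longrightarrow> (\<forall>t::real. t \<ge> 0 \<longrightarrow> norm (X (of_real t) z) < r))"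

definition globally_asymptotically_stable_origin ::
    "(complex ^ 'n \<Rightarrow> complex ^ 'n) \<Rightarrow> (complex \<Rightarrow> complex ^ 'n \<Rightarrow> complex ^ 'n) \<Rightarrow> bool" where
  "globally_asymptotically_stable_origin V X \<longleftrightarrow>
     V 0 = 0 \<and> lyapunov_stable_origin X \<and>
     (\<forall>z. ((\<lambda>t::real. X (of_real t) z) \<longlongrightarrow> 0) at_top)"

text \<open>The instances of \<open>times\<close> and \<open>power\<close> for \<open>vec\<close> are componentwise, so the powers in the matrix
  exponential are iterated products with \<open>**\<close> instead.\<close>

definition matrix_power :: "complex ^ 'n ^ 'n \<Rightarrow> nat \<Rightarrow> complex ^ 'n ^ 'n" where
  "matrix_power A k = (((**) A) ^^ k) (mat 1)"

definition matrix_exp :: "complex ^ 'n ^ 'n \<Rightarrow> complex ^ 'n ^ 'n" where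
  "matrix_exp A = (\<Sum>k. (1 / fact k) *\<^sub>R matrix_power A k)"

text \<open>\<open>exp_mult c A\<close> is the exponential of the scalar multiple \<open>c A\<close>.\<close>

definition exp_mult :: "complex \<Rightarrow> complex ^ 'n ^ 'n \<Rightarrow> complex ^ 'n ^ 'n" where
  "exp_mult c A = matrix_exp (map_matrix (\<lambda>a. c * a) A)"

definition locally_uniform_limit ::
    "('i \<Rightarrow> 'a::topological_space \<Rightarrow> 'b::metric_space) \<Rightarrow> ('a \<Rightarrow> 'b) \<Rightarrow> 'i filter \<Rightarrow> bool" where
  "locally_uniform_limit f g \<F> \<longleftrightarrow>
     (\<forall>z. \<exists>U. open U \<and> z \<in> U \<and> uniform_limit U f g \<F>)"

definition improper_integral_converges_uniformly_on ::
    "'a set \<Rightarrow> (real \<Rightarrow> 'a \<Rightarrow> 'b::euclidean_space) \<Rightarrow> bool" where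
  "improper_integral_converges_uniformly_on K f \<longleftrightarrow>
     (\<forall>z\<in>K. \<forall>T\<ge>0. (\<lambda>s. f s z) integrable_on {0..T}) \<and>
     (\<exists>I. uniform_limit K (\<lambda>T z. integral {0..T} (\<lambda>s. f s z)) I at_top)"

end

theory Submission
  imports Defs "HOL-Complex_Analysis.Cauchy_Integral_Formula"
begin

text \<open>
  Write \<open>\<Phi>\<^sub>t(z) = e\<^sup>-\<^sup>t\<^sup>A X\<^sub>t(z)\<close>.  By the product rule \<open>\<Phi>\<^sub>t(z) - z\<close> is the integral over \<open>[0,t]\<close> of
  \<open>e\<^sup>-\<^sup>s\<^sup>A R(X\<^sub>s(z))\<close>, so the hypothesis says that \<open>\<Phi>\<^sub>t\<close> converges uniformly on compact sets to a map \<open>F\<close>.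

  Holomorphy of \<open>F\<close> rests on two facts.  A locally uniform limit of holomorphic maps is holomorphic and
  the derivatives converge too (\<open>holomorphic_map_limit\<close>, from the Cauchy estimate on complex lines); and
  each \<open>X\<^sub>t\<close> is holomorphic in \<open>z\<close> (\<open>flow_holomorphic\<close>).  The second is an application of the first: the
  Euler iterates of \<open>z \<mapsto> z + (t/n) V(z)\<close> are compositions of holomorphic maps and converge locally uniformly
  to \<open>X\<^sub>t\<close>.  Neither the variational equation nor a separate uniqueness theorem is needed, since
  the convergence of the Euler method also shows that the solutions are unique, which gives the group law
  (\<open>flow_add\<close>).

  On \<open>[0,t]\<close> the flow is Lipschitz at the fixed point \<open>0\<close>, so \<open>R(z) = o(norm z)\<close> makes \<open>\<Phi>\<^sub>t(z) - z\<close> an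
  \<open>o(norm z)\<close>: the derivative of \<open>\<Phi>\<^sub>t\<close> at \<open>0\<close> is the identity, and hence so is that of \<open>F\<close>.

  For real \<open>s\<close>, \<open>\<Phi>\<^sub>t \<circ> X\<^sub>s = e\<^sup>s\<^sup>A \<Phi>\<^sub>s\<^sub>+\<^sub>t\<close>, and letting \<open>t \<longrightarrow> \<infinity>\<close> gives \<open>F \<circ> X\<^sub>s = e\<^sup>s\<^sup>A F\<close>.  Differentiating at \<open>s = 0\<close>
  yields \<open>DF(z) V(z) = A F(z)\<close>, which extends the relation to complex times (\<open>conjugacy_complex_time\<close>).

  Finally \<open>F\<close> is an automorphism (\<open>conjugacy_attracting_Aut\<close>): by the inverse function theorem it maps a
  neighbourhood \<open>U\<close> of \<open>0\<close> biholomorphically onto a neighbourhood \<open>N\<close> of \<open>0\<close>.  Every orbit of \<open>X\<close> enters \<open>U\<close>,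
  and every orbit of the linear flow enters \<open>N\<close>, so injectivity, surjectivity and holomorphy of the inverse
  are transported from \<open>U\<close> and \<open>N\<close> to the whole space.
\<close>

section \<open>Bilinear operations and complex linear maps on tuples\<close>

lemma norm_vector_scalar_mult: "norm (c *s (v :: complex ^ 'n)) = cmod c * norm v"
  by (simp add: norm_vec_def norm_mult L2_set_right_distrib)

lemma scaleR_eq_vector_scalar_mult: "a *\<^sub>R (v :: complex ^ 'n) = complex_of_real a *s v"
  unfolding vec_eq_iff vector_scaleR_component vector_smult_component
  by (simp add: scaleR_conv_of_real)

lemma bounded_bilinear_vector_scalar_mult:
  "bounded_bilinear ((*s) :: complex \<Rightarrow> complex ^ 'n \<Rightarrow> complex ^ 'n)"
  unfolding bilinear_conv_bounded_bilinear[symmetric] bilinear_def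
  by (auto intro!: linearI simp: vec_eq_iff algebra_simps)

lemma bounded_bilinear_matrix_vector_mult:
  "bounded_bilinear ((*v) :: complex ^ 'n ^ 'n \<Rightarrow> complex ^ 'n \<Rightarrow> complex ^ 'n)"
  unfolding bilinear_conv_bounded_bilinear[symmetric] bilinear_def
  by (auto intro!: linearI simp: vec_eq_iff matrix_vector_mult_def algebra_simps sum.distrib
      scaleR_sum_right)

lemma bounded_bilinear_matrix_matrix_mult:
  "bounded_bilinear ((**) :: complex ^ 'n ^ 'n \<Rightarrow> complex ^ 'n ^ 'n \<Rightarrow> complex ^ 'n ^ 'n)"
  unfolding bilinear_conv_bounded_bilinear[symmetric] bilinear_def
  by (auto intro!: linearI simp: matrix_matrix_mult_def vec_eq_iff algebra_simps sum.distrib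
      scaleR_sum_right)

lemma norm_le_card_mult:
  fixes v :: "complex ^ 'n"
  assumes "\<And>i. cmod (v $ i) \<le> B"
  shows "norm v \<le> real CARD('n) * B"
proof -
  have "norm v \<le> (\<Sum>i\<in>UNIV. cmod (v $ i))"
    by (simp add: norm_vec_def L2_set_le_sum)
  also have "\<dots> \<le> (\<Sum>i\<in>(UNIV :: 'n set). B)"
    by (intro sum_mono assms)
  finally show ?thesis by simp
qed

lemma matrix_mult_vector_scalar: "A *v (c *s v) = c *s (A *v (v :: complex ^ 'n))"
  by (simp add: vector_scalar_commute)

text \<open>A real linear map that commutes with complex scalars is given by a complex matrix.\<close>

lemma complex_linear_matrix:
  fixes f :: "complex ^ 'n \<Rightarrow> complex ^ 'n"
  assumes "linear f" and "\<And>c v. f (c *s v) = c *s f v"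
  shows "f = (*v) (matrix f)"
proof -
  have "Vector_Spaces.linear (*s) (*s) f"
    using assms by unfold_locales (auto simp: linear_add algebra_simps)
  then show ?thesis
    by (auto simp: matrix_works)
qed

section \<open>Elementary properties of holomorphic maps\<close>

lemma holomorphic_map_derivative:
  assumes "holomorphic_map f"
  obtains D where "\<And>z. (f has_derivative (\<lambda>h. D z *v h)) (at z)"
  using assms unfolding holomorphic_map_def by metis

lemma holomorphic_map_family_derivative:
  assumes "\<And>n. holomorphic_map (f n)"
  obtains D where "\<And>n z. (f n has_derivative (\<lambda>h. D n z *v h)) (at z)"
proof
  show "(f n has_derivative (\<lambda>h. (SOME D. (f n has_derivative (\<lambda>h. D *v h)) (at z)) *v h)) (at z)" for n z
    using assms[of n] unfolding holomorphic_map_def by (auto intro: someI_ex)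
qed

lemma holomorphic_mapI:
  assumes "\<And>z. (f has_derivative (\<lambda>h. D z *v h)) (at z)"
  shows "holomorphic_map f"
  using assms unfolding holomorphic_map_def by blast

lemma holomorphic_map_continuous:
  assumes "holomorphic_map f"
  shows "continuous_on S f"
  using assms unfolding holomorphic_map_def
  by (meson continuous_at_imp_continuous_on has_derivative_continuous)

lemma holomorphic_map_compose:
  assumes "holomorphic_map f" "holomorphic_map g"
  shows "holomorphic_map (\<lambda>z. f (g z))"
proof -
  obtain D where D: "\<And>z. (f has_derivative (\<lambda>h. D z *v h)) (at z)"
    using holomorphic_map_derivative[OF assms(1)] by blast
  obtain E where E: "\<And>z. (g has_derivative (\<lambda>h. E z *v h)) (at z)"
    using holomorphic_map_derivative[OF assms(2)] by blast
  show ?thesis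
    by (rule holomorphic_mapI[where D = "\<lambda>z. D (g z) ** E z"])
      (use has_derivative_compose[OF E D] in \<open>simp add: matrix_vector_mul_assoc\<close>)
qed

lemma holomorphic_map_linear: "holomorphic_map ((*v) A)"
  by (rule holomorphic_mapI[where D = "\<lambda>_. A"])
    (simp add: bounded_linear_imp_has_derivative)

lemma matrix_of_scalar: "(c *s v :: complex ^ 'n) = map_matrix (\<lambda>a. c * a) (mat 1) *v v"
  by (simp add: vec_eq_iff matrix_vector_mult_def map_matrix_def mat_def if_distrib[of "(*) c"]
      if_distrib[of "\<lambda>x. x * _"] sum.delta' cong: if_cong)

lemma holomorphic_map_id: "holomorphic_map (\<lambda>z :: complex ^ 'n. z)"
proof -
  have "(*v) (mat 1) = (\<lambda>z :: complex ^ 'n. z)"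
    by (simp add: fun_eq_iff)
  with holomorphic_map_linear[of "mat 1 :: complex ^ 'n ^ 'n"] show ?thesis by metis
qed

lemma holomorphic_map_scalar:
  assumes "holomorphic_map f"
  shows "holomorphic_map (\<lambda>z. c *s f z)"
  using holomorphic_map_compose[OF holomorphic_map_linear assms] by (simp add: matrix_of_scalar)

lemma holomorphic_map_add:
  assumes "holomorphic_map f" "holomorphic_map g"
  shows "holomorphic_map (\<lambda>z. f z + g z)"
proof -
  obtain D where D: "\<And>z. (f has_derivative (\<lambda>h. D z *v h)) (at z)"
    using holomorphic_map_derivative[OF assms(1)] by blast
  obtain E where E: "\<And>z. (g has_derivative (\<lambda>h. E z *v h)) (at z)"
    using holomorphic_map_derivative[OF assms(2)] by blast
  show ?thesis
    by (rule holomorphic_mapI[where D = "\<lambda>z. D z + E z"])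
      (use has_derivative_add[OF D E] in \<open>simp add: matrix_vector_mult_add_rdistrib\<close>)
qed

lemma holomorphic_map_funpow:
  assumes "holomorphic_map f"
  shows "holomorphic_map (f ^^ n)"
proof (induction n)
  case 0
  show ?case using holomorphic_map_id by (simp add: id_def)
next
  case (Suc n)
  show ?case using holomorphic_map_compose[OF assms Suc] by (simp add: o_def)
qed

section \<open>Cauchy estimates and limits of holomorphic maps\<close>

text \<open>The estimate is the one-variable Cauchy inequality on the complex line through \<open>z\<close> in
  direction \<open>h\<close>, on the circle of radius \<open>r / norm h\<close>.\<close>

lemma holomorphic_map_Cauchy_estimate:
  fixes g :: "complex ^ 'n \<Rightarrow> complex ^ 'n"
  assumes g: "\<And>w. (g has_derivative (\<lambda>h. D w *v h)) (at w)"
    and "r > 0" and bound: "\<And>w. norm (w - z) \<le> r \<Longrightarrow> norm (g w) \<le> B"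
  shows "norm (D z *v h) \<le> real CARD('n) * B / r * norm h"
proof (cases "h = 0")
  case False
  have "cmod ((D z *v h) $ i) \<le> B / r * norm h" for i
  proof -
    define p where "p = (\<lambda>\<zeta>. g (z + \<zeta> *s h) $ i)"
    have p: "(p has_field_derivative (D (z + \<zeta> *s h) *v h) $ i) (at \<zeta>)" for \<zeta>
    proof -
      have "((\<lambda>\<zeta>. z + \<zeta> *s h) has_derivative (\<lambda>k. k *s h)) (at \<zeta>)"
        using bounded_bilinear.bounded_linear_left[OF bounded_bilinear_vector_scalar_mult, of h]
        by (auto intro!: derivative_eq_intros bounded_linear_imp_has_derivative)
      from has_derivative_compose[OF this g]
      have "((\<lambda>\<zeta>. g (z + \<zeta> *s h)) has_derivative (\<lambda>k. k *s (D (z + \<zeta> *s h) *v h))) (at \<zeta>)"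
        by (simp add: matrix_mult_vector_scalar)
      from bounded_linear.has_derivative[OF bounded_linear_vec_nth this, of i]
      show ?thesis
        unfolding has_field_derivative_def p_def
        by (rule has_derivative_eq_rhs) (simp add: fun_eq_iff)
    qed
    have "p holomorphic_on UNIV"
      using p by (auto simp: holomorphic_on_def field_differentiable_def intro: has_field_derivative_at_within)
    moreover have "norm (p \<zeta>) \<le> B" if "norm (0 - \<zeta>) = r / norm h" for \<zeta>
    proof -
      have "norm (g (z + \<zeta> *s h)) \<le> B"
        using that False by (intro bound) (simp add: norm_vector_scalar_mult)
      then show ?thesis
        unfolding p_def using Finite_Cartesian_Product.norm_nth_le[of "g (z + \<zeta> *s h)" i] by linarith
    qed
    ultimately have "norm ((deriv ^^ 1) p 0) \<le> fact 1 * B / (r / norm h) ^ 1"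
      using False \<open>r > 0\<close>
      by (intro Cauchy_inequality)
        (auto intro: holomorphic_on_subset holomorphic_on_imp_continuous_on)
    then show ?thesis
      using DERIV_imp_deriv[OF p[of 0]] by simp
  qed
  then have "norm (D z *v h) \<le> real CARD('n) * (B / r * norm h)"
    by (rule norm_le_card_mult)
  then show ?thesis by simp
qed simp

text \<open>The derivative is continuous in the operator norm, because the Cauchy estimate on
  the unit ball bounds the derivative of the difference of \<open>f\<close> and its translate by \<open>y - z\<close>.\<close>

lemma holomorphic_map_derivative_continuous:
  fixes f :: "complex ^ 'n \<Rightarrow> complex ^ 'n"
  assumes f: "\<And>w. (f has_derivative (\<lambda>h. D w *v h)) (at w)"
  shows "continuous_on UNIV (\<lambda>z. Blinfun (\<lambda>h. D z *v h))"
proof -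
  have "isCont (\<lambda>z. Blinfun (\<lambda>h. D z *v h)) z" for z
    unfolding continuous_at_eps_delta
  proof (intro allI impI)
    fix e :: real assume "e > 0"
    define c where "c = real CARD('n)"
    have "c > 0" by (simp add: c_def)
    have "continuous_on (cball z 2) f"
      using f holomorphic_map_continuous holomorphic_mapI by blast
    then have "uniformly_continuous_on (cball z 2) f"
      by (simp add: compact_uniformly_continuous)
    then obtain d where "d > 0"
      and d: "\<And>x y. x \<in> cball z 2 \<Longrightarrow> y \<in> cball z 2 \<Longrightarrow> dist y x < d \<Longrightarrow> dist (f y) (f x) < e / (2 * c)"
      unfolding uniformly_continuous_on_def using \<open>e > 0\<close> \<open>c > 0\<close>
      by (metis divide_pos_pos mult_pos_pos zero_less_numeral)
    show "\<exists>d>0. \<forall>y. dist y z < d \<longrightarrow> dist (Blinfun (\<lambda>h. D y *v h)) (Blinfun (\<lambda>h. D z *v h)) < e"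
    proof (intro exI[of _ "min d 1"] conjI allI impI)
      fix y assume y: "dist y z < min d 1"
      define g where "g w = f (y - z + w) - f w" for w
      have g: "(g has_derivative (\<lambda>h. (D (y - z + w) - D w) *v h)) (at w)" for w
      proof -
        have "((\<lambda>w. f (y - z + w)) has_derivative (\<lambda>h. D (y - z + w) *v h)) (at w)"
          by (rule has_derivative_compose[where g = f and f = "\<lambda>w. y - z + w"])
            (auto intro!: derivative_eq_intros f)
        from has_derivative_diff[OF this f] show ?thesis
          unfolding g_def by (simp add: matrix_vector_mult_diff_rdistrib)
      qed
      have "norm (g w) \<le> e / (2 * c)" if "norm (w - z) \<le> 1" for w
      proof -
        have "dist z (y - z + w) \<le> dist y z + norm (w - z)"
          unfolding dist_norm by norm
        then show ?thesis
          using that y d[of w "y - z + w"]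
          by (auto simp: g_def dist_norm norm_minus_commute)
      qed
      then have b: "norm ((D y - D z) *v h) \<le> c * (e / (2 * c)) / 1 * norm h" for h
        using holomorphic_map_Cauchy_estimate[OF g, of 1 z "e / (2 * c)" h] unfolding c_def by simp
      have "norm (Blinfun (\<lambda>h. D y *v h) - Blinfun (\<lambda>h. D z *v h)) \<le> e / 2"
        using b \<open>e > 0\<close> \<open>c > 0\<close>
        by (intro norm_blinfun_bound)
          (auto simp: blinfun.diff_left bounded_linear_Blinfun_apply matrix_vector_mult_diff_rdistrib)
      then show "dist (Blinfun (\<lambda>h. D y *v h)) (Blinfun (\<lambda>h. D z *v h)) < e"
        using \<open>e > 0\<close> by (simp add: dist_norm)
    qed (use \<open>d > 0\<close> in auto)
  qed
  then show ?thesis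
    by (simp add: continuous_at_imp_continuous_on)
qed

lemma holomorphic_map_Lipschitz_on_ball:
  fixes f :: "complex ^ 'n \<Rightarrow> complex ^ 'n"
  assumes "holomorphic_map f"
  obtains L M where "L \<ge> 0" "M \<ge> 0" "\<And>a. norm a \<le> \<rho> \<Longrightarrow> norm (f a) \<le> M"
    "\<And>a b. norm a \<le> \<rho> \<Longrightarrow> norm b \<le> \<rho> \<Longrightarrow> norm (f a - f b) \<le> L * norm (a - b)"
proof -
  obtain D where D: "\<And>z. (f has_derivative (\<lambda>h. D z *v h)) (at z)"
    using holomorphic_map_derivative[OF assms] by blast
  have "compact (f ` cball 0 (\<rho> + 1))"
    using holomorphic_map_continuous[OF assms] by (intro compact_continuous_image) auto
  then obtain M where "M > 0" and M: "\<And>a. norm a \<le> \<rho> + 1 \<Longrightarrow> norm (f a) \<le> M"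
    using compact_imp_bounded bounded_pos by (metis image_eqI mem_cball_0)
  have est: "norm (D a *v h) \<le> real CARD('n) * M * norm h" if "norm a \<le> \<rho>" for a h
  proof -
    have "norm (f w) \<le> M" if "norm (w - a) \<le> 1" for w
      using M[of w] norm_triangle_sub[of w a] that \<open>norm a \<le> \<rho>\<close> by linarith
    from holomorphic_map_Cauchy_estimate[OF D zero_less_one this] show ?thesis by simp
  qed
  have "norm (f a - f b) \<le> (real CARD('n) * M) * norm (a - b)" if "norm a \<le> \<rho>" "norm b \<le> \<rho>" for a b
  proof (rule differentiable_bound[where S = "cball 0 \<rho>"])
    show "(f has_derivative (\<lambda>h. D x *v h)) (at x within cball 0 \<rho>)" for x
      using D has_derivative_at_withinI by blast
    show "onorm (\<lambda>h. D x *v h) \<le> real CARD('n) * M" if "x \<in> cball 0 \<rho>" for x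
      using that \<open>M > 0\<close> by (intro onorm_le est) auto
  qed (use that in auto)
  with M \<open>M > 0\<close> show ?thesis
    by (intro that[of "real CARD('n) * M" M]) auto
qed

text \<open>The Weierstrass convergence theorem.  By the Cauchy estimate the derivatives form a locally
  uniform Cauchy sequence.\<close>

lemma holomorphic_map_limit:
  fixes f :: "nat \<Rightarrow> complex ^ 'n \<Rightarrow> complex ^ 'n"
  assumes f: "\<And>n z. (f n has_derivative (\<lambda>h. D n z *v h)) (at z)"
    and lim: "\<And>z. \<exists>r>0. uniform_limit (cball z r) f F sequentially"
  shows "\<exists>D'. \<forall>z. (F has_derivative (\<lambda>h. D' z *v h)) (at z) \<and>
    (\<forall>h. (\<lambda>n. D n z *v h) \<longlonglongrightarrow> D' z *v h)"
proof -
  define c where "c = real CARD('n)"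
  have "c > 0" by (simp add: c_def)
  have cauchy: "\<exists>N. \<forall>m\<ge>N. \<forall>n\<ge>N. \<forall>x\<in>ball z (r / 2). \<forall>h. norm (D m x *v h - D n x *v h) \<le> e * norm h"
    if "r > 0" and u: "uniform_limit (cball z r) f F sequentially" and "e > 0" for z r e
  proof -
    have "uniformly_Cauchy_on (cball z r) f"
      using u uniformly_convergent_Cauchy uniformly_convergent_on_def by blast
    moreover have "e * r / (2 * c) > 0" using \<open>e > 0\<close> \<open>r > 0\<close> \<open>c > 0\<close> by simp
    ultimately obtain N where N: "\<And>x m n. x \<in> cball z r \<Longrightarrow> m \<ge> N \<Longrightarrow> n \<ge> N \<Longrightarrow>
        dist (f m x) (f n x) < e * r / (2 * c)"
      unfolding uniformly_Cauchy_on_def by metis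
    have "norm (D m x *v h - D n x *v h) \<le> e * norm h"
      if "m \<ge> N" "n \<ge> N" "x \<in> ball z (r / 2)" for m n x h
    proof -
      have g: "((\<lambda>w. f m w - f n w) has_derivative (\<lambda>h. (D m w - D n w) *v h)) (at w)" for w
        using has_derivative_diff[OF f[of m w] f[of n w]] by (simp add: matrix_vector_mult_diff_rdistrib)
      have "norm (f m w - f n w) \<le> e * r / (2 * c)" if "norm (w - x) \<le> r / 2" for w
      proof -
        have "dist z w \<le> dist z x + norm (w - x)" unfolding dist_norm by norm
        then have "w \<in> cball z r" using \<open>x \<in> ball z (r / 2)\<close> that by auto
        with N[OF this \<open>m \<ge> N\<close> \<open>n \<ge> N\<close>] show ?thesis by (simp add: dist_norm)
      qed
      then have "norm ((D m x - D n x) *v h) \<le> c * (e * r / (2 * c)) / (r / 2) * norm h"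
        unfolding c_def using \<open>r > 0\<close> by (intro holomorphic_map_Cauchy_estimate[OF g]) auto
      then show ?thesis
        using \<open>r > 0\<close> \<open>c > 0\<close> by (simp add: matrix_vector_mult_diff_rdistrib)
    qed
    then show ?thesis by blast
  qed
  have "\<exists>M. \<forall>h. (\<lambda>n. D n z *v h) \<longlonglongrightarrow> M *v h" for z
  proof -
    obtain r where "r > 0" "uniform_limit (cball z r) f F sequentially" using lim by blast
    note cz = cauchy[OF this]
    have "Cauchy (\<lambda>n. D n z *v h)" for h
    proof (rule CauchyI)
      fix e :: real assume "e > 0"
      then have "e / (norm h + 1) > 0" by (simp add: add_nonneg_pos)
      from cz[OF this] obtain N where N: "\<And>m n. m \<ge> N \<Longrightarrow> n \<ge> N \<Longrightarrow>
          norm (D m z *v h - D n z *v h) \<le> e / (norm h + 1) * norm h"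
        using \<open>r > 0\<close> by (metis centre_in_ball half_gt_zero)
      have "e / (norm h + 1) * norm h < e"
        using \<open>e > 0\<close> by (simp add: divide_simps add_nonneg_pos)
      with N show "\<exists>M. \<forall>m\<ge>M. \<forall>n\<ge>M. norm (D m z *v h - D n z *v h) < e"
        by (meson le_less_trans)
    qed
    then have "\<exists>l. (\<lambda>n. D n z *v h) \<longlonglongrightarrow> l" for h
      by (simp add: convergent_eq_Cauchy)
    then obtain l where l: "\<And>h. (\<lambda>n. D n z *v h) \<longlonglongrightarrow> l h" by metis
    have "linear l"
    proof (rule linearI)
      show "l (a + b) = l a + l b" for a b
        by (rule LIMSEQ_unique[OF l])
          (simp add: matrix_vector_right_distrib tendsto_add[OF l l])
      show "l (c *\<^sub>R b) = c *\<^sub>R l b" for c b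
        by (rule LIMSEQ_unique[OF l])
          (simp add: linear_scale[OF matrix_vector_mul_linear] tendsto_scaleR[OF tendsto_const l])
    qed
    moreover have scal: "l (c *s b) = c *s l b" for c b
      by (rule LIMSEQ_unique[OF l])
        (simp add: matrix_mult_vector_scalar
          bounded_bilinear.tendsto[OF bounded_bilinear_vector_scalar_mult tendsto_const l])
    ultimately have "l h = matrix l *v h" for h
      using complex_linear_matrix[of l] by metis
    with l have "\<forall>h. (\<lambda>n. D n z *v h) \<longlonglongrightarrow> matrix l *v h" by simp
    then show ?thesis by blast
  qed
  then obtain D' where D': "\<And>z h. (\<lambda>n. D n z *v h) \<longlonglongrightarrow> D' z *v h" by metis
  have "(F has_derivative (\<lambda>h. D' z *v h)) (at z)" for z
  proof -
    obtain r where "r > 0" and u: "uniform_limit (cball z r) f F sequentially" using lim by blast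
    have Flim: "(\<lambda>n. f n x) \<longlonglongrightarrow> F x" if "x \<in> ball z (r / 2)" for x
      using u by (rule tendsto_uniform_limitI) (use that \<open>r > 0\<close> in auto)
    have "\<exists>g. \<forall>x\<in>ball z (r / 2). (\<lambda>n. f n x) \<longlonglongrightarrow> g x \<and>
        (g has_derivative (\<lambda>h. D' x *v h)) (at x within ball z (r / 2))"
    proof (rule has_derivative_sequence[where f' = "\<lambda>n x h. D n x *v h"])
      show "(f n has_derivative (\<lambda>h. D n x *v h)) (at x within ball z (r / 2))" for n x
        using f has_derivative_at_withinI by blast
      show "\<forall>\<^sub>F n in sequentially. \<forall>x\<in>ball z (r / 2). \<forall>h. norm (D n x *v h - D' x *v h) \<le> e * norm h"
        if e: "e > 0" for e
      proof -
        obtain N where N: "\<And>m n x h. m \<ge> N \<Longrightarrow> n \<ge> N \<Longrightarrow> x \<in> ball z (r / 2) \<Longrightarrow>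
            norm (D m x *v h - D n x *v h) \<le> e * norm h"
          using cauchy[OF \<open>r > 0\<close> u e] by blast
        have "norm (D n x *v h - D' x *v h) \<le> e * norm h" if "n \<ge> N" "x \<in> ball z (r / 2)" for n x h
        proof (rule tendsto_upperbound)
          show "(\<lambda>m. norm (D n x *v h - D m x *v h)) \<longlonglongrightarrow> norm (D n x *v h - D' x *v h)"
            by (intro tendsto_intros D')
          show "\<forall>\<^sub>F m in sequentially. norm (D n x *v h - D m x *v h) \<le> e * norm h"
            using N[OF that(1) _ that(2)] eventually_sequentially by blast
        qed simp
        then show ?thesis
          unfolding eventually_sequentially by blast
      qed
      show "z \<in> ball z (r / 2)" "(\<lambda>n. f n z) \<longlonglongrightarrow> F z"
        using Flim \<open>r > 0\<close> by auto
    qed simp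
    then obtain g where g: "\<And>x. x \<in> ball z (r / 2) \<Longrightarrow> (\<lambda>n. f n x) \<longlonglongrightarrow> g x"
      and dg: "\<And>x. x \<in> ball z (r / 2) \<Longrightarrow> (g has_derivative (\<lambda>h. D' x *v h)) (at x within ball z (r / 2))"
      by blast
    have gF: "g x = F x" if "x \<in> ball z (r / 2)" for x
      using g[OF that] Flim[OF that] LIMSEQ_unique by blast
    have "(g has_derivative (\<lambda>h. D' z *v h)) (at z)"
      using dg[of z] \<open>r > 0\<close> by (simp add: at_within_open[of z "ball z (r / 2)"])
    then show ?thesis
      by (rule has_derivative_transform_within_open[OF _ open_ball[of z "r / 2"]])
        (use gF \<open>r > 0\<close> in auto)
  qed
  with D' show ?thesis by (intro exI[of _ D'] allI conjI)
qed

corollary holomorphic_map_uniform_limit: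
  fixes f :: "nat \<Rightarrow> complex ^ 'n \<Rightarrow> complex ^ 'n"
  assumes f: "\<And>n. holomorphic_map (f n)"
    and lim: "\<And>z. \<exists>r>0. uniform_limit (cball z r) f F sequentially"
  shows "holomorphic_map F"
proof -
  obtain D where D: "\<And>n z. (f n has_derivative (\<lambda>h. D n z *v h)) (at z)"
    by (rule holomorphic_map_family_derivative[of f, OF f]) (erule that)
  have "\<exists>D'. \<forall>z. (F has_derivative (\<lambda>h. D' z *v h)) (at z) \<and>
      (\<forall>h. (\<lambda>n. D n z *v h) \<longlonglongrightarrow> D' z *v h)"
    by (rule holomorphic_map_limit[OF D lim])
  then show ?thesis unfolding holomorphic_map_def by blast
qed

section \<open>The matrix exponential\<close>

lemma matrix_scale_mult_left:
  "map_matrix (\<lambda>a. c * a) M ** N = map_matrix (\<lambda>a. c * a) (M ** (N :: complex ^ 'n ^ 'n))"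
  by (simp add: vec_eq_iff matrix_matrix_mult_def map_matrix_def sum_distrib_left mult.assoc)

lemma matrix_scale_mult_right:
  "M ** map_matrix (\<lambda>a. c * a) N = map_matrix (\<lambda>a. c * a) (M ** (N :: complex ^ 'n ^ 'n))"
  by (simp add: vec_eq_iff matrix_matrix_mult_def map_matrix_def sum_distrib_left mult.left_commute)

lemma matrix_scale_mult_vector:
  "map_matrix (\<lambda>a. c * a) M *v w = c *s (M *v (w :: complex ^ 'n))"
  by (simp add: vec_eq_iff matrix_vector_mult_def map_matrix_def sum_distrib_left mult.assoc)

lemma has_derivative_vecI:
  fixes f :: "'a::real_normed_vector \<Rightarrow> ('b::euclidean_space) ^ 'n"
  assumes "\<And>i. ((\<lambda>x. f x $ i) has_derivative (\<lambda>h. f' h $ i)) (at a within S)"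
  shows "(f has_derivative f') (at a within S)"
  by (subst has_derivative_componentwise_within)
    (auto simp: Basis_vec_def inner_axis intro!: has_derivative_inner_left assms)

lemma matrix_power_Suc: "matrix_power A (Suc k) = A ** matrix_power A k"
  by (simp add: matrix_power_def)

lemma matrix_power_0: "matrix_power A 0 = mat 1"
  by (simp add: matrix_power_def)

lemma matrix_power_commute: "A ** matrix_power A k = matrix_power A k ** A"
  by (induction k) (simp_all add: matrix_power_0 matrix_power_Suc matrix_mul_assoc)

lemma matrix_power_scale:
  "matrix_power (map_matrix (\<lambda>a. c * a) A) k = map_matrix (\<lambda>a. c ^ k * a) (matrix_power A k)"
proof (induction k)
  case 0
  show ?case by (simp add: matrix_power_0 vec_eq_iff map_matrix_def)
next
  case (Suc k)
  then show ?case
    by (simp add: matrix_power_Suc matrix_scale_mult_left matrix_scale_mult_right)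
      (simp add: vec_eq_iff map_matrix_def mult.assoc)
qed

lemma matrix_power_entry_bound:
  "cmod (matrix_power A k $ i $ j) \<le> (\<Sum>i\<in>UNIV. \<Sum>j\<in>UNIV. cmod (A $ i $ j)) ^ k"
proof (induction k arbitrary: i j)
  case 0
  show ?case by (simp add: matrix_power_0 mat_def)
next
  case (Suc k)
  define C where "C = (\<Sum>i\<in>UNIV. \<Sum>j\<in>UNIV. cmod (A $ i $ j))"
  have "C \<ge> 0" unfolding C_def by (intro sum_nonneg) auto
  have "cmod (matrix_power A (Suc k) $ i $ j) \<le> (\<Sum>l\<in>UNIV. cmod (A $ i $ l * matrix_power A k $ l $ j))"
    by (simp add: matrix_power_Suc matrix_matrix_mult_def norm_sum)
  also have "\<dots> \<le> (\<Sum>l\<in>UNIV. cmod (A $ i $ l) * C ^ k)"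
    using Suc unfolding C_def by (intro sum_mono) (auto simp: norm_mult intro!: mult_left_mono)
  also have "\<dots> = (\<Sum>l\<in>UNIV. cmod (A $ i $ l)) * C ^ k"
    by (simp add: sum_distrib_right)
  also have "\<dots> \<le> C * C ^ k"
    using \<open>C \<ge> 0\<close> unfolding C_def
    by (intro mult_right_mono member_le_sum[of i UNIV "\<lambda>i. \<Sum>l\<in>UNIV. cmod (A $ i $ l)"])
      (auto intro: sum_nonneg)
  finally show ?case unfolding C_def by simp
qed

lemma exp_mult_entry_summable: "summable (\<lambda>k. matrix_power A k $ i $ j / fact k * c ^ k)"
proof (rule summable_comparison_test')
  define C where "C = (\<Sum>i\<in>UNIV. \<Sum>j\<in>UNIV. cmod (A $ i $ j))"
  show "summable (\<lambda>k. inverse (fact k) * (C * cmod c) ^ k)"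
    by (rule summable_exp)
  show "norm (matrix_power A k $ i $ j / fact k * c ^ k) \<le> inverse (fact k) * (C * cmod c) ^ k"
    if "k \<ge> 0" for k
    using matrix_power_entry_bound[of A k i j]
    unfolding C_def
    by (simp add: norm_mult norm_divide norm_power power_mult_distrib divide_simps mult_right_mono)
qed

text \<open>Every entry of \<open>exp_mult c A\<close> is an everywhere convergent power series in \<open>c\<close>.\<close>

lemma exp_mult_entry:
  fixes A :: "complex ^ 'n ^ 'n"
  shows "exp_mult c A $ i $ j = (\<Sum>k. matrix_power A k $ i $ j / fact k * c ^ k)"
proof -
  define S :: "complex ^ 'n ^ 'n" where "S = (\<chi> i j. \<Sum>k. matrix_power A k $ i $ j / fact k * c ^ k)"
  have "(\<lambda>k. (1 / fact k) *\<^sub>R matrix_power (map_matrix (\<lambda>a. c * a) A) k) sums S"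
    unfolding sums_def
  proof (intro vec_tendstoI)
    fix i j
    have "(\<lambda>k. matrix_power A k $ i $ j / fact k * c ^ k) sums (S $ i $ j)"
      unfolding S_def using summable_sums[OF exp_mult_entry_summable] by simp
    moreover have "((1 / fact k) *\<^sub>R matrix_power (map_matrix (\<lambda>a. c * a) A) k) $ i $ j
        = matrix_power A k $ i $ j / fact k * c ^ k" for k
    proof -
      have "((1 / fact k) *\<^sub>R matrix_power (map_matrix (\<lambda>a. c * a) A) k) $ i $ j
        = complex_of_real (1 / fact k) * (c ^ k * matrix_power A k $ i $ j)"
        unfolding matrix_power_scale vector_scaleR_component
        by (simp only: map_matrix_def vec_lambda_beta scaleR_conv_of_real)
      then show ?thesis by simp
    qed
    ultimately show "(\<lambda>n. (\<Sum>k<n. (1 / fact k) *\<^sub>R matrix_power (map_matrix (\<lambda>a. c * a) A) k) $ i $ j)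
        \<longlonglongrightarrow> S $ i $ j"
      by (simp add: sums_def)
  qed
  then have "exp_mult c A = S"
    unfolding exp_mult_def matrix_exp_def by (rule sums_unique[symmetric])
  then show ?thesis by (simp add: S_def)
qed

lemma exp_mult_0: "exp_mult 0 A = mat 1"
proof -
  have "exp_mult 0 A $ i $ j = mat 1 $ i $ j" for i j
    unfolding exp_mult_entry using powser_zero[of "\<lambda>k. matrix_power A k $ i $ j / fact k"]
    by (simp add: matrix_power_0)
  then show ?thesis by (simp add: vec_eq_iff)
qed

lemma exp_mult_mult_entry:
  "(A ** exp_mult c A) $ i $ j = (\<Sum>k. matrix_power A (Suc k) $ i $ j / fact k * c ^ k)"
proof -
  have "(\<lambda>k. \<Sum>l\<in>UNIV. A $ i $ l * (matrix_power A k $ l $ j / fact k * c ^ k))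
      sums (\<Sum>l\<in>UNIV. A $ i $ l * exp_mult c A $ l $ j)"
    unfolding exp_mult_entry
    by (intro sums_sum sums_mult summable_sums exp_mult_entry_summable)
  then show ?thesis
    by (simp add: sums_iff matrix_power_Suc matrix_matrix_mult_def sum_divide_distrib
        sum_distrib_right mult.assoc)
qed

lemma exp_mult_commute: "A ** exp_mult c A = exp_mult c A ** A"
proof -
  have "(A ** exp_mult c A) $ i $ j = (exp_mult c A ** A) $ i $ j" for i j
  proof -
    have "(\<lambda>k. \<Sum>l\<in>UNIV. (matrix_power A k $ i $ l / fact k * c ^ k) * A $ l $ j)
        sums (\<Sum>l\<in>UNIV. exp_mult c A $ i $ l * A $ l $ j)"
      unfolding exp_mult_entry
      by (intro sums_sum sums_mult2 summable_sums exp_mult_entry_summable)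
    moreover have "(\<Sum>l\<in>UNIV. (matrix_power A k $ i $ l / fact k * c ^ k) * A $ l $ j)
        = matrix_power A (Suc k) $ i $ j / fact k * c ^ k" for k
      unfolding matrix_power_Suc matrix_power_commute
      by (simp add: matrix_matrix_mult_def sum_divide_distrib sum_distrib_right sum_distrib_left
          algebra_simps)
    ultimately show ?thesis
      unfolding exp_mult_mult_entry by (simp add: sums_iff matrix_matrix_mult_def)
  qed
  then show ?thesis by (simp add: vec_eq_iff)
qed

lemma exp_mult_has_derivative:
  "((\<lambda>c. exp_mult c A) has_derivative (\<lambda>h. map_matrix (\<lambda>a. h * a) (A ** exp_mult c A))) (at c within S)"
proof (intro has_derivative_vecI)
  fix i j
  have "((\<lambda>c. \<Sum>k. matrix_power A k $ i $ j / fact k * c ^ k) has_field_derivative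
      (\<Sum>k. diffs (\<lambda>k. matrix_power A k $ i $ j / fact k) k * c ^ k)) (at c)"
    by (rule termdiffs_strong_converges_everywhere[OF exp_mult_entry_summable])
  moreover have "diffs (\<lambda>k. matrix_power A k $ i $ j / fact k) k = matrix_power A (Suc k) $ i $ j / fact k" for k
    unfolding diffs_def fact_Suc of_nat_mult by (simp del: of_nat_Suc)
  ultimately have "((\<lambda>c. exp_mult c A $ i $ j) has_field_derivative (A ** exp_mult c A) $ i $ j) (at c)"
    by (simp add: exp_mult_entry exp_mult_mult_entry)
  then have "((\<lambda>c. exp_mult c A $ i $ j) has_field_derivative (A ** exp_mult c A) $ i $ j) (at c within S)"
    by (rule has_field_derivative_at_within)
  then show "((\<lambda>c. exp_mult c A $ i $ j) has_derivative
      (\<lambda>h. map_matrix (\<lambda>a. h * a) (A ** exp_mult c A) $ i $ j)) (at c within S)"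
    unfolding has_field_derivative_def
    by (rule has_derivative_eq_rhs) (simp add: fun_eq_iff map_matrix_def)
qed

lemma exp_mult_uminus_add: "exp_mult (- c) A ** exp_mult (c + d) A = exp_mult d A"
proof -
  define G where "G c = exp_mult (- c) A ** exp_mult (c + d) A" for c
  have "(G has_derivative (\<lambda>h. 0)) (at c)" for c
  proof -
    have 1: "((\<lambda>c. exp_mult (- c) A) has_derivative
        (\<lambda>h. map_matrix (\<lambda>a. - h * a) (A ** exp_mult (- c) A))) (at c)"
      by (rule has_derivative_compose[OF _ exp_mult_has_derivative]) (auto intro!: derivative_eq_intros)
    have 2: "((\<lambda>c. exp_mult (c + d) A) has_derivative
        (\<lambda>h. map_matrix (\<lambda>a. h * a) (A ** exp_mult (c + d) A))) (at c)"
      by (rule has_derivative_compose[OF _ exp_mult_has_derivative]) (auto intro!: derivative_eq_intros)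
    have "exp_mult (- c) A ** map_matrix (\<lambda>a. h * a) (A ** exp_mult (c + d) A)
        + map_matrix (\<lambda>a. - h * a) (A ** exp_mult (- c) A) ** exp_mult (c + d) A = 0" for h
      unfolding exp_mult_commute[of A "- c"] matrix_scale_mult_left matrix_scale_mult_right
        matrix_mul_assoc
      by (simp add: vec_eq_iff map_matrix_def)
    then show ?thesis
      unfolding G_def
      by (intro has_derivative_eq_rhs[OF bounded_bilinear.FDERIV
            [OF bounded_bilinear_matrix_matrix_mult 1 2]])
        (simp add: fun_eq_iff)
  qed
  then have "G c = G 0"
    by (intro has_derivative_zero_unique[where s = UNIV and f = G]) auto
  then show ?thesis
    by (simp add: G_def exp_mult_0)
qed

lemma exp_mult_inverse: "exp_mult (- c) A *v (exp_mult c A *v w) = w"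
  using exp_mult_uminus_add[of c A 0] by (simp add: matrix_vector_mul_assoc exp_mult_0)

lemma exp_mult_inverse': "exp_mult c A *v (exp_mult (- c) A *v w) = w"
  using exp_mult_inverse[of "- c" A w] by simp

lemma exp_mult_continuous: "continuous_on S (\<lambda>c. exp_mult c A)"
  using exp_mult_has_derivative by (rule has_derivative_continuous_on)

text \<open>The twisted derivative along a curve \<open>x\<close>: the product rule leaves only the deviation of \<open>x'\<close> from
  the linear field \<open>A x\<close>.\<close>

lemma exp_mult_curve_has_derivative:
  assumes "(x has_derivative (\<lambda>h. h *s v)) (at c within S)"
  shows "((\<lambda>c. exp_mult (- c) A *v x c) has_derivative
    (\<lambda>h. h *s (exp_mult (- c) A *v (v - A *v x c)))) (at c within S)"
proof -
  have 1: "((\<lambda>c. exp_mult (- c) A) has_derivative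
      (\<lambda>h. map_matrix (\<lambda>a. - h * a) (A ** exp_mult (- c) A))) (at c within S)"
    by (rule has_derivative_compose[OF _ exp_mult_has_derivative]) (auto intro!: derivative_eq_intros)
  have "exp_mult (- c) A *v (h *s v) + map_matrix (\<lambda>a. - h * a) (A ** exp_mult (- c) A) *v x c
      = h *s (exp_mult (- c) A *v (v - A *v x c))" for h
    unfolding exp_mult_commute
    by (simp only: matrix_scale_mult_vector matrix_mult_vector_scalar matrix_vector_mult_diff_distrib
        matrix_vector_mul_assoc[symmetric]) (simp add: vec_eq_iff algebra_simps)
  then show ?thesis
    by (intro has_derivative_eq_rhs[OF bounded_bilinear.FDERIV
          [OF bounded_bilinear_matrix_vector_mult 1 assms]])
      (simp add: fun_eq_iff)
qed

section \<open>The Euler method\<close>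

text \<open>\<open>euler W n z\<close> is the result of \<open>n\<close> explicit Euler steps of length \<open>1 / n\<close> for \<open>x' = W(x)\<close> from
  \<open>x(0) = z\<close>, an approximation of the time-one value.  Other times, also complex ones, are reached by
  rescaling \<open>W\<close>.\<close>

definition euler :: "('a::real_normed_vector \<Rightarrow> 'a) \<Rightarrow> nat \<Rightarrow> 'a \<Rightarrow> 'a" where
  "euler W n = (\<lambda>u. u + (1 / real n) *\<^sub>R W u) ^^ n"

lemma euler_local_error:
  fixes x :: "real \<Rightarrow> 'a::real_normed_vector"
  assumes sol: "\<And>s. s \<in> {a..b} \<Longrightarrow> (x has_vector_derivative W (x s)) (at s within {a..b})"
    and tube: "\<And>s. s \<in> {a..b} \<Longrightarrow> norm (x s) \<le> \<rho>"
    and lip: "\<And>u v. norm u \<le> \<rho> \<Longrightarrow> norm v \<le> \<rho> \<Longrightarrow> norm (W u - W v) \<le> L * norm (u - v)"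
    and bound: "\<And>u. norm u \<le> \<rho> \<Longrightarrow> norm (W u) \<le> M"
    and "L \<ge> 0" "M \<ge> 0" "a \<le> b"
  shows "norm (x b - x a - (b - a) *\<^sub>R W (x a)) \<le> (b - a) * (L * (M * (b - a)))"
proof -
  have dist: "norm (x s - x a) \<le> M * (b - a)" if s: "s \<in> {a..b}" for s
  proof -
    have "norm (x s - x a) \<le> M * norm (s - a)"
    proof (rule differentiable_bound[where S = "{a..b}" and f' = "\<lambda>s h. h *\<^sub>R W (x s)"])
      show "(x has_derivative (\<lambda>h. h *\<^sub>R W (x s))) (at s within {a..b})" if "s \<in> {a..b}" for s
        using sol[OF that] by (simp add: has_vector_derivative_def)
      show "onorm (\<lambda>h. h *\<^sub>R W (x s)) \<le> M" if "s \<in> {a..b}" for s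
        using bound[OF tube[OF that]] by (intro onorm_le) (simp add: mult.commute[of M] mult_left_mono)
    qed (use s \<open>a \<le> b\<close> in auto)
    also have "\<dots> \<le> M * (b - a)"
      using s \<open>M \<ge> 0\<close> by (intro mult_left_mono) auto
    finally show ?thesis .
  qed
  have "norm (x b - x a - (b - a) *\<^sub>R W (x a)) \<le> norm (b - a) * (L * (M * (b - a)))"
  proof (rule vector_differentiable_bound_linearization[where S = "{a..b}"])
    show "closed_segment a b \<subseteq> {a..b}" using \<open>a \<le> b\<close> by (simp add: closed_segment_eq_real_ivl)
    show "norm (W (x s) - W (x a)) \<le> L * (M * (b - a))" if "s \<in> {a..b}" for s
      using lip[OF tube[OF that] tube[of a]] dist[OF that] \<open>L \<ge> 0\<close> \<open>a \<le> b\<close>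
      by (smt (verit) atLeastAtMost_iff mult_left_mono)
  qed (use sol \<open>a \<le> b\<close> in auto)
  then show ?thesis using \<open>a \<le> b\<close> by simp
qed

text \<open>Global error of the Euler method, for an initial value \<open>z\<close> that need not lie on the solution \<open>x\<close>.
  The smallness assumption keeps the iterates within distance \<open>1\<close> of \<open>x\<close>, hence in the ball on which
  the Lipschitz constant is valid.\<close>

lemma euler_error:
  fixes x :: "real \<Rightarrow> 'a::real_normed_vector"
  assumes sol: "\<And>s. s \<in> {0..1} \<Longrightarrow> (x has_vector_derivative W (x s)) (at s within {0..1})"
    and tube: "\<And>s. s \<in> {0..1} \<Longrightarrow> norm (x s) + 1 \<le> \<rho>"
    and lip: "\<And>u v. norm u \<le> \<rho> \<Longrightarrow> norm v \<le> \<rho> \<Longrightarrow> norm (W u - W v) \<le> L * norm (u - v)"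
    and bound: "\<And>u. norm u \<le> \<rho> \<Longrightarrow> norm (W u) \<le> M"
    and "L \<ge> 0" "M \<ge> 0" "n > 0"
    and small: "(norm (z - x 0) + L * M / n) * exp L \<le> 1"
  shows "norm (euler W n z - x 1) \<le> (norm (z - x 0) + L * M / n) * exp L"
proof -
  define u where "u k = ((\<lambda>u. u + (1 / real n) *\<^sub>R W u) ^^ k) z" for k
  define e where "e = norm (z - x 0)"
  have "e \<ge> 0" by (simp add: e_def)
  have LM: "L * M \<ge> 0" using \<open>L \<ge> 0\<close> \<open>M \<ge> 0\<close> by simp
  have crude: "(e + k * (L * M / n\<^sup>2)) * (1 + L / n) ^ k \<le> (e + L * M / n) * exp L" if "k \<le> n" for k
  proof -
    have "k * (L * M / n\<^sup>2) \<le> n * (L * M / n\<^sup>2)"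
      using that LM by (intro mult_right_mono) auto
    also have "\<dots> = L * M / n"
      using \<open>n > 0\<close> by (simp add: power2_eq_square)
    finally have "e + k * (L * M / n\<^sup>2) \<le> e + L * M / n" by simp
    moreover have "(1 + L / n) ^ k \<le> (1 + L / n) ^ n"
      using that \<open>L \<ge> 0\<close> by (intro power_increasing) auto
    moreover have "(1 + L / n) ^ n \<le> exp L"
      using \<open>L \<ge> 0\<close> \<open>n > 0\<close> by (intro exp_ge_one_plus_x_over_n_power_n) auto
    ultimately show ?thesis
      using \<open>e \<ge> 0\<close> LM \<open>L \<ge> 0\<close> by (intro mult_mono) auto
  qed
  have alg: "q * ((e + real k * p) * q ^ k) + p * q ^ Suc k = (e + real (Suc k) * p) * q ^ Suc k"
    for p q :: real and k
    by (simp add: algebra_simps)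
  \<comment> \<open>\<open>crude\<close> and \<open>small\<close> bound the error of step \<open>k\<close> by \<open>1\<close>, which keeps the next step in the ball of radius \<open>\<rho>\<close>\<close>
  have main: "norm (u k - x (k / n)) \<le> (e + k * (L * M / n\<^sup>2)) * (1 + L / n) ^ k" if "k \<le> n" for k
    using that
  proof (induction k)
    case 0
    show ?case by (simp add: u_def e_def)
  next
    case (Suc k)
    define a b where "a = real k / n" and "b = real (Suc k) / n"
    have ab: "b - a = 1 / n" "0 \<le> a" "a \<le> b" "b \<le> 1"
      using Suc.prems \<open>n > 0\<close> by (auto simp: a_def b_def field_simps)
    have IH: "norm (u k - x a) \<le> (e + k * (L * M / n\<^sup>2)) * (1 + L / n) ^ k"
      using Suc by (simp add: a_def)
    also have "\<dots> \<le> 1"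
      using crude[of k] Suc.prems small by (simp add: e_def)
    finally have "norm (u k) \<le> \<rho>"
      using tube[of a] ab norm_triangle_sub[of "u k" "x a"] by auto
    have "norm (x a) \<le> \<rho>" using tube[of a] ab by auto
    have loc: "norm (x b - x a - (b - a) *\<^sub>R W (x a)) \<le> (b - a) * (L * (M * (b - a)))"
    proof (rule euler_local_error[where W = W and \<rho> = \<rho>])
      show "(x has_vector_derivative W (x s)) (at s within {a..b})" if "s \<in> {a..b}" for s
        using sol[of s] that ab by (auto intro: has_vector_derivative_within_subset)
      show "norm (x s) \<le> \<rho>" if "s \<in> {a..b}" for s
        using tube[of s] that ab by auto
    qed (use lip bound \<open>L \<ge> 0\<close> \<open>M \<ge> 0\<close> ab in auto)
    have usuc: "u (Suc k) = u k + (b - a) *\<^sub>R W (u k)"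
      by (simp add: u_def ab)
    have "norm (u (Suc k) - x b) = norm ((u k - x a) + (b - a) *\<^sub>R (W (u k) - W (x a))
        - (x b - x a - (b - a) *\<^sub>R W (x a)))"
      unfolding usuc by (simp add: algebra_simps)
    also have "\<dots> \<le> norm (u k - x a) + norm ((b - a) *\<^sub>R (W (u k) - W (x a)))
        + norm (x b - x a - (b - a) *\<^sub>R W (x a))"
      by (meson add_mono norm_triangle_ineq norm_triangle_ineq4 order_refl order_trans)
    also have "\<dots> \<le> norm (u k - x a) + (1 / n) * (L * norm (u k - x a)) + (1 / n) * (L * (M * (1 / n)))"
      using loc lip[OF \<open>norm (u k) \<le> \<rho>\<close> \<open>norm (x a) \<le> \<rho>\<close>] ab
      by (intro add_mono) (auto intro: divide_right_mono)
    also have "\<dots> = (1 + L / n) * norm (u k - x a) + L * M / n\<^sup>2"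
      by (simp add: algebra_simps power2_eq_square)
    also have "\<dots> \<le> (1 + L / n) * ((e + k * (L * M / n\<^sup>2)) * (1 + L / n) ^ k) + L * M / n\<^sup>2 * (1 + L / n) ^ Suc k"
    proof (intro add_mono mult_left_mono)
      have "(1 + L / n) ^ Suc k \<ge> 1"
        using \<open>L \<ge> 0\<close> by (intro one_le_power) auto
      then show "L * M / n\<^sup>2 \<le> L * M / n\<^sup>2 * (1 + L / n) ^ Suc k"
        using LM mult_left_mono[of 1 "(1 + L / n) ^ Suc k" "L * M / n\<^sup>2"] by simp
    qed (use IH \<open>L \<ge> 0\<close> in auto)
    also have "\<dots> = (e + Suc k * (L * M / n\<^sup>2)) * (1 + L / n) ^ Suc k"
      by (rule alg)
    finally show ?case by (simp add: b_def)
  qed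
  have "norm (u n - x 1) \<le> (e + L * M / n) * exp L"
    using main[of n] crude[of n] \<open>n > 0\<close> by simp
  then show ?thesis by (simp add: u_def e_def euler_def)
qed

lemma euler_tendsto:
  fixes x :: "real \<Rightarrow> 'a::real_normed_vector"
  assumes sol: "\<And>s. s \<in> {0..1} \<Longrightarrow> (x has_vector_derivative W (x s)) (at s within {0..1})"
    and tube: "\<And>s. s \<in> {0..1} \<Longrightarrow> norm (x s) + 1 \<le> \<rho>"
    and lip: "\<And>u v. norm u \<le> \<rho> \<Longrightarrow> norm v \<le> \<rho> \<Longrightarrow> norm (W u - W v) \<le> L * norm (u - v)"
    and bound: "\<And>u. norm u \<le> \<rho> \<Longrightarrow> norm (W u) \<le> M"
    and "L \<ge> 0" "M \<ge> 0"
  shows "(\<lambda>n. euler W n (x 0)) \<longlonglongrightarrow> x 1"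
proof -
  have lim: "(\<lambda>n. (L * M / real n) * exp L) \<longlonglongrightarrow> 0"
    by (intro tendsto_mult_left_zero lim_const_over_n)
  have "eventually (\<lambda>n. (L * M / real n) * exp L < 1) sequentially"
    by (rule order_tendstoD(2)[OF lim]) simp
  then have "eventually (\<lambda>n. norm (euler W n (x 0) - x 1) \<le> (L * M / real n) * exp L) sequentially"
    using eventually_gt_at_top[of 0]
  proof eventually_elim
    case (elim n)
    have "(norm (x 0 - x 0) + L * M / n) * exp L \<le> 1"
      using less_imp_le[OF elim(1)] by (simp only: diff_self norm_zero add_0)
    from euler_error[OF sol tube lip bound \<open>L \<ge> 0\<close> \<open>M \<ge> 0\<close> elim(2) this] show ?case by simp
  qed
  then have "(\<lambda>n. euler W n (x 0) - x 1) \<longlonglongrightarrow> 0"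
    using lim by (rule Lim_null_comparison)
  then show ?thesis by (simp add: LIM_zero_iff)
qed

section \<open>Complex flows of holomorphic vector fields\<close>

lemma flow_path:
  assumes "is_complex_flow V X"
  shows "((\<lambda>s::real. X (c + of_real s * t) z) has_vector_derivative t *s V (X (c + of_real s * t) z))
    (at s within S)"
proof -
  have "((\<lambda>s. X s z) has_derivative (\<lambda>h. h *s V (X (c + of_real s * t) z))) (at (c + of_real s * t))"
    using assms unfolding is_complex_flow_def by blast
  moreover have "((\<lambda>s::real. c + of_real s * t) has_derivative (\<lambda>h. of_real h * t)) (at s within S)"
    by (auto intro!: derivative_eq_intros)
  ultimately have "((\<lambda>s::real. X (c + of_real s * t) z) has_derivative
      (\<lambda>h. (of_real h * t) *s V (X (c + of_real s * t) z))) (at s within S)"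
    using has_derivative_compose by blast
  then show ?thesis
    by (simp add: has_vector_derivative_def scaleR_eq_vector_scalar_mult vector_smult_assoc)
qed

text \<open>The Euler iterates depend only on \<open>t\<close> and the initial value, so this includes uniqueness of the
  solution through a given point.\<close>

lemma euler_tendsto_path:
  fixes V :: "complex ^ 'n \<Rightarrow> complex ^ 'n"
  assumes "holomorphic_map V"
    and sol: "\<And>s. s \<in> {0..1} \<Longrightarrow> (x has_vector_derivative t *s V (x s)) (at s within {0..1})"
  shows "(\<lambda>n. euler (\<lambda>u. t *s V u) n (x 0)) \<longlonglongrightarrow> x 1"
proof -
  have "continuous_on {0..1} x"
    using sol by (meson has_vector_derivative_continuous continuous_on_eq_continuous_within)
  then have "bounded (x ` {0..1})"
    by (intro compact_imp_bounded compact_continuous_image) auto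
  then obtain B where B: "\<And>s. s \<in> {0..1} \<Longrightarrow> norm (x s) \<le> B"
    unfolding bounded_iff by blast
  obtain L M where LM: "L \<ge> 0" "M \<ge> 0" "\<And>a. norm a \<le> B + 1 \<Longrightarrow> norm (t *s V a) \<le> M"
    "\<And>a b. norm a \<le> B + 1 \<Longrightarrow> norm b \<le> B + 1 \<Longrightarrow> norm (t *s V a - t *s V b) \<le> L * norm (a - b)"
    using holomorphic_map_Lipschitz_on_ball[OF holomorphic_map_scalar[OF assms(1)]] by metis
  show ?thesis
    by (rule euler_tendsto[where \<rho> = "B + 1" and L = L and M = M]) (use sol B LM in auto)
qed

lemma flow_euler_tendsto:
  fixes V :: "complex ^ 'n \<Rightarrow> complex ^ 'n"
  assumes "holomorphic_map V" and "is_complex_flow V X"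
  shows "(\<lambda>n. euler (\<lambda>u. t *s V u) n z) \<longlonglongrightarrow> X t z"
  using euler_tendsto_path[where t = t and x = "\<lambda>s. X (0 + of_real s * t) z", OF assms(1)
      flow_path[OF assms(2)]] assms(2)
  by (simp add: is_complex_flow_def)

text \<open>Both sides are the limit of the same Euler iterates, started at \<open>X s z\<close>.\<close>

lemma flow_add:
  fixes V :: "complex ^ 'n \<Rightarrow> complex ^ 'n"
  assumes "holomorphic_map V" and "is_complex_flow V X"
  shows "X t (X s z) = X (s + t) z"
proof -
  have "(\<lambda>n. euler (\<lambda>u. t *s V u) n (X s z)) \<longlonglongrightarrow> X (s + t) z"
    using euler_tendsto_path[where t = t and x = "\<lambda>\<sigma>. X (s + of_real \<sigma> * t) z", OF assms(1)
      flow_path[OF assms(2)]] by simp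
  with flow_euler_tendsto[OF assms] show ?thesis
    using LIMSEQ_unique by blast
qed

lemma flow_inverse:
  fixes V :: "complex ^ 'n \<Rightarrow> complex ^ 'n"
  assumes "holomorphic_map V" and "is_complex_flow V X"
  shows "X t (X (- t) z) = z"
  using flow_add[OF assms, of t "- t" z] assms(2) by (simp add: is_complex_flow_def)

lemma flow_bounded_path:
  assumes "is_complex_flow V X"
  obtains B where "\<And>s. s \<in> {0..1} \<Longrightarrow> norm (X (complex_of_real s * t) z) \<le> B"
proof -
  have "continuous_on {0..1} (\<lambda>s. X (0 + complex_of_real s * t) z)"
    using flow_path[OF assms]
    by (meson has_vector_derivative_continuous continuous_on_eq_continuous_within)
  then have "bounded ((\<lambda>s. X (0 + complex_of_real s * t) z) ` {0..1})"
    by (intro compact_imp_bounded compact_continuous_image) auto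
  then obtain B where "\<forall>y\<in>(\<lambda>s. X (0 + complex_of_real s * t) z) ` {0..1}. norm y \<le> B"
    unfolding bounded_iff by blast
  then show ?thesis
    by (intro that[of B]) simp
qed

text \<open>The Euler iterates from \<open>z\<close> stay near the orbit of \<open>z0\<close> and converge to the orbit of \<open>z\<close>, so
  the error estimate passes to the limit.  The same constants serve all times \<open>s t\<close> with
  \<open>s \<in> {0..1}\<close>, because the field \<open>s t V\<close> obeys the bounds for \<open>t V\<close>.\<close>

lemma flow_Lipschitz:
  fixes V :: "complex ^ 'n \<Rightarrow> complex ^ 'n"
  assumes V: "holomorphic_map V" and X: "is_complex_flow V X"
  obtains \<delta> C where "\<delta> > 0" "C \<ge> 0"
    "\<And>z s. norm (z - z0) \<le> \<delta> \<Longrightarrow> s \<in> {0..1} \<Longrightarrow>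
      norm (X (of_real s * t) z - X (of_real s * t) z0) \<le> C * norm (z - z0)"
proof -
  obtain B where B: "\<And>s. s \<in> {0..1} \<Longrightarrow> norm (X (complex_of_real s * t) z0) \<le> B"
    using flow_bounded_path[OF X] by blast
  obtain L M where LM: "L \<ge> 0" "M \<ge> 0" "\<And>a. norm a \<le> B + 1 \<Longrightarrow> norm (t *s V a) \<le> M"
    "\<And>a b. norm a \<le> B + 1 \<Longrightarrow> norm b \<le> B + 1 \<Longrightarrow> norm (t *s V a - t *s V b) \<le> L * norm (a - b)"
    using holomorphic_map_Lipschitz_on_ball[OF holomorphic_map_scalar[OF V]] by metis
  define \<delta> where "\<delta> = exp (- L) / 2"
  have "norm (X (of_real s * t) z - X (of_real s * t) z0) \<le> exp L * norm (z - z0)"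
    if z: "norm (z - z0) \<le> \<delta>" and s: "s \<in> {0..1}" for z s
  proof (rule tendsto_le[OF sequentially_bot])
    let ?W = "\<lambda>u. (of_real s * t) *s V u"
    have W: "?W u = s *\<^sub>R (t *s V u)" for u
      by (simp add: scaleR_eq_vector_scalar_mult vector_smult_assoc)
    show "(\<lambda>n. norm (euler ?W n z - X (of_real s * t) z0))
        \<longlonglongrightarrow> norm (X (of_real s * t) z - X (of_real s * t) z0)"
      by (intro tendsto_intros flow_euler_tendsto V X)
    have "(\<lambda>n. (norm (z - z0) + L * M / real n) * exp L) \<longlonglongrightarrow> (norm (z - z0) + 0) * exp L"
      by (intro tendsto_intros lim_const_over_n)
    then show lim: "(\<lambda>n. (norm (z - z0) + L * M / real n) * exp L) \<longlonglongrightarrow> exp L * norm (z - z0)"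
      by (simp add: mult.commute)
    have "exp L * norm (z - z0) \<le> exp L * \<delta>"
      using z by simp
    also have "\<dots> < 1" by (simp add: \<delta>_def exp_minus)
    finally have "\<forall>\<^sub>F n in sequentially. (norm (z - z0) + L * M / real n) * exp L < 1"
      using order_tendstoD(2)[OF lim] by blast
    then show "\<forall>\<^sub>F n in sequentially. norm (euler ?W n z - X (of_real s * t) z0)
        \<le> (norm (z - z0) + L * M / real n) * exp L"
      using eventually_gt_at_top[of 0]
    proof eventually_elim
      case (elim n)
      define x where "x \<sigma> = X (0 + of_real \<sigma> * (of_real s * t)) z0" for \<sigma> :: real
      have x01: "x 0 = z0" "x 1 = X (of_real s * t) z0"
        using X by (simp_all add: x_def is_complex_flow_def)
      have "norm (euler ?W n z - x 1) \<le> (norm (z - x 0) + L * M / n) * exp L"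
      proof (rule euler_error[where \<rho> = "B + 1"])
        show "(x has_vector_derivative ?W (x \<sigma>)) (at \<sigma> within {0..1})" for \<sigma>
          unfolding x_def by (rule flow_path[OF X])
        show "norm (x \<sigma>) + 1 \<le> B + 1" if "\<sigma> \<in> {0..1}" for \<sigma>
          using B[of "\<sigma> * s"] that s by (simp add: x_def mult.assoc mult_le_one)
        show "norm (?W u) \<le> M" if "norm u \<le> B + 1" for u
        proof -
          have "norm (?W u) \<le> 1 * norm (t *s V u)"
            unfolding W using s by (simp add: mult_left_le_one_le)
          with LM(3)[OF that] show ?thesis by simp
        qed
        show "norm (?W u - ?W v) \<le> L * norm (u - v)" if "norm u \<le> B + 1" "norm v \<le> B + 1" for u v
        proof -
          have "norm (?W u - ?W v) \<le> 1 * norm (t *s V u - t *s V v)"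
            unfolding W scaleR_diff_right[symmetric] using s by (simp add: mult_left_le_one_le)
          with LM(4)[OF that] show ?thesis by simp
        qed
      qed (use LM elim x01 in auto)
      then show ?case by (simp add: x01)
    qed
  qed
  moreover have "\<delta> > 0" by (simp add: \<delta>_def)
  ultimately show ?thesis using that[of \<delta> "exp L"] by simp
qed

text \<open>The Lipschitz estimate keeps the orbits of all \<open>z\<close> near \<open>z0\<close> in one ball, which makes the Euler
  error uniform in \<open>z\<close>.\<close>

lemma flow_euler_uniform_limit:
  fixes V :: "complex ^ 'n \<Rightarrow> complex ^ 'n"
  assumes V: "holomorphic_map V" and X: "is_complex_flow V X"
  shows "\<exists>r>0. uniform_limit (cball z0 r) (euler (\<lambda>u. t *s V u)) (X t) sequentially"
proof -
  obtain \<delta> C where dC: "\<delta> > 0" "C \<ge> 0"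
    "\<And>z s. norm (z - z0) \<le> \<delta> \<Longrightarrow> s \<in> {0..1} \<Longrightarrow>
      norm (X (of_real s * t) z - X (of_real s * t) z0) \<le> C * norm (z - z0)"
    using flow_Lipschitz[OF V X] by blast
  obtain B where B: "\<And>s. s \<in> {0..1} \<Longrightarrow> norm (X (complex_of_real s * t) z0) \<le> B"
    using flow_bounded_path[OF X] by blast
  obtain L M where LM: "L \<ge> 0" "M \<ge> 0" "\<And>a. norm a \<le> B + 2 \<Longrightarrow> norm (t *s V a) \<le> M"
    "\<And>a b. norm a \<le> B + 2 \<Longrightarrow> norm b \<le> B + 2 \<Longrightarrow> norm (t *s V a - t *s V b) \<le> L * norm (a - b)"
    using holomorphic_map_Lipschitz_on_ball[OF holomorphic_map_scalar[OF V]] by metis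
  define r where "r = min \<delta> (1 / (C + 1))"
  have "r > 0" using dC by (simp add: r_def)
  have lim: "(\<lambda>n. (L * M / real n) * exp L) \<longlonglongrightarrow> 0"
    by (intro tendsto_mult_left_zero lim_const_over_n)
  have est: "norm (euler (\<lambda>u. t *s V u) n z - X t z) \<le> (L * M / n) * exp L"
    if z: "z \<in> cball z0 r" and n: "n > 0" "(L * M / real n) * exp L < 1" for n z
  proof -
    define x where "x \<sigma> = X (0 + of_real \<sigma> * t) z" for \<sigma> :: real
    have x01: "x 0 = z" "x 1 = X t z"
      using X by (simp_all add: x_def is_complex_flow_def)
    have zd: "norm (z - z0) \<le> \<delta>" "norm (z - z0) \<le> 1 / (C + 1)"
      using z by (auto simp: r_def dist_norm norm_minus_commute)
    have "norm (euler (\<lambda>u. t *s V u) n z - x 1) \<le> (norm (z - x 0) + L * M / n) * exp L"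
    proof (rule euler_error[where \<rho> = "B + 2"])
      show "(x has_vector_derivative t *s V (x \<sigma>)) (at \<sigma> within {0..1})" for \<sigma>
        unfolding x_def by (rule flow_path[OF X])
      show "norm (x \<sigma>) + 1 \<le> B + 2" if "\<sigma> \<in> {0..1}" for \<sigma>
      proof -
        have "C * norm (z - z0) \<le> C * (1 / (C + 1))"
          using zd dC by (intro mult_left_mono) auto
        also have "\<dots> \<le> 1" using dC by (simp add: divide_simps)
        finally have "norm (X (of_real \<sigma> * t) z - X (of_real \<sigma> * t) z0) \<le> 1"
          using dC(3)[OF zd(1) that] by simp
        then show ?thesis
          using B[OF that] norm_triangle_sub[of "X (of_real \<sigma> * t) z" "X (of_real \<sigma> * t) z0"]
          by (simp add: x_def)
      qed
    qed (use LM n x01 in auto)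
    then show ?thesis by (simp add: x01)
  qed
  have "uniform_limit (cball z0 r) (euler (\<lambda>u. t *s V u)) (X t) sequentially"
    unfolding uniform_limit_iff
  proof (intro allI impI)
    fix e :: real assume "e > 0"
    then have "\<forall>\<^sub>F n in sequentially. (L * M / real n) * exp L < min 1 e"
      by (intro order_tendstoD(2)[OF lim]) auto
    then show "\<forall>\<^sub>F n in sequentially. \<forall>z\<in>cball z0 r. dist (euler (\<lambda>u. t *s V u) n z) (X t z) < e"
      using eventually_gt_at_top[of 0]
    proof eventually_elim
      case (elim n)
      show ?case
      proof
        fix z assume "z \<in> cball z0 r"
        from est[OF this elim(2)] elim(1)
        show "dist (euler (\<lambda>u. t *s V u) n z) (X t z) < e"
          unfolding dist_norm by linarith
      qed
    qed
  qed
  with \<open>r > 0\<close> show ?thesis by blast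
qed

lemma holomorphic_map_euler:
  assumes "holomorphic_map V"
  shows "holomorphic_map (euler (\<lambda>u. t *s V u) n)"
  unfolding euler_def scaleR_eq_vector_scalar_mult
  by (intro holomorphic_map_funpow holomorphic_map_add holomorphic_map_id holomorphic_map_scalar assms)

text \<open>A flow depends holomorphically on the initial value, as a locally uniform limit of the Euler
  iterates, which are compositions of holomorphic maps.\<close>

theorem flow_holomorphic:
  fixes V :: "complex ^ 'n \<Rightarrow> complex ^ 'n"
  assumes V: "holomorphic_map V" and X: "is_complex_flow V X"
  shows "holomorphic_map (X t)"
  by (rule holomorphic_map_uniform_limit[OF holomorphic_map_euler[OF V] flow_euler_uniform_limit[OF V X]])

section \<open>Linearization at an attracting fixed point\<close>

lemma twisted_flow_has_integral:
  assumes X: "is_complex_flow V X" and R: "\<And>z. V z = A *v z + R z" and "T \<ge> 0"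
  shows "((\<lambda>s. exp_mult (- of_real s) A *v R (X (of_real s) z)) has_integral
    (exp_mult (- of_real T) A *v X (of_real T) z - z)) {0..T}"
proof -
  define \<Phi> where "\<Phi> c = exp_mult (- c) A *v X c z" for c
  have "((\<lambda>s. \<Phi> (complex_of_real s)) has_vector_derivative
      exp_mult (- of_real s) A *v R (X (of_real s) z)) (at s within {0..T})" for s
  proof -
    have "((\<lambda>c. X c z) has_derivative (\<lambda>h. h *s V (X (of_real s) z))) (at (of_real s))"
      using X unfolding is_complex_flow_def by blast
    from exp_mult_curve_has_derivative[OF this, of A]
    have "(\<Phi> has_derivative (\<lambda>h. h *s (exp_mult (- of_real s) A *v R (X (of_real s) z)))) (at (of_real s))"
      unfolding \<Phi>_def by (simp add: R)
    moreover have "(complex_of_real has_derivative of_real) (at s within {0..T})"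
      by (auto intro!: derivative_eq_intros)
    ultimately have "((\<lambda>s. \<Phi> (complex_of_real s)) has_derivative
        (\<lambda>h. of_real h *s (exp_mult (- of_real s) A *v R (X (of_real s) z)))) (at s within {0..T})"
      by (rule has_derivative_compose[rotated])
    then show ?thesis
      by (simp add: has_vector_derivative_def scaleR_eq_vector_scalar_mult)
  qed
  from fundamental_theorem_of_calculus[OF \<open>T \<ge> 0\<close> this]
  show ?thesis
    using X by (simp add: \<Phi>_def exp_mult_0 is_complex_flow_def)
qed

lemma flow_fixed_point:
  fixes V :: "complex ^ 'n \<Rightarrow> complex ^ 'n"
  assumes "holomorphic_map V" and "is_complex_flow V X" and "V p = 0"
  shows "X t p = p"
proof -
  have "(\<lambda>n. euler (\<lambda>u. t *s V u) n p) \<longlonglongrightarrow> p"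
    using euler_tendsto_path[where t = t and x = "\<lambda>_. p", OF assms(1)] assms(3) by simp
  with flow_euler_tendsto[OF assms(1,2)] show ?thesis
    using LIMSEQ_unique by blast
qed

text \<open>On \<open>{0..T}\<close> the flow is Lipschitz at the origin, so the integral of the twisted remainder
  is \<open>o(norm z)\<close>.\<close>

lemma twisted_flow_derivative_at_origin:
  fixes V R :: "complex ^ 'n \<Rightarrow> complex ^ 'n"
  assumes V: "holomorphic_map V" and X: "is_complex_flow V X" and "V 0 = 0"
    and R: "\<And>z. V z = A *v z + R z"
    and small: "(\<lambda>z. norm (R z)) \<in> o[at 0](\<lambda>z. norm z)" and "T \<ge> 0"
  shows "((\<lambda>z. exp_mult (- of_real T) A *v X (of_real T) z) has_derivative (\<lambda>h. h)) (at 0)"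
  unfolding has_derivative_at_alt
proof (intro conjI allI impI bounded_linear_ident)
  fix e :: real assume "e > 0"
  define \<Phi> where "\<Phi> z = exp_mult (- of_real T) A *v X (of_real T) z" for z
  have X0: "X c 0 = 0" for c
    using flow_fixed_point[OF V X \<open>V 0 = 0\<close>] .
  have R0: "R 0 = 0" using R[of 0] \<open>V 0 = 0\<close> by simp
  obtain \<delta> C where dC: "\<delta> > 0" "C \<ge> 0"
    "\<And>z s. norm (z - 0) \<le> \<delta> \<Longrightarrow> s \<in> {0..1} \<Longrightarrow>
      norm (X (of_real s * of_real T) z - X (of_real s * of_real T) 0) \<le> C * norm (z - 0)"
    using flow_Lipschitz[OF V X, of 0 "of_real T"] by blast
  have XC: "norm (X (of_real s) z) \<le> C * norm z" if "norm z \<le> \<delta>" "s \<in> {0..T}" for z s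
  proof -
    have "s / T \<in> {0..1}" using that by (auto simp: divide_le_eq_1)
    moreover have "of_real (s / T) * of_real T = complex_of_real s"
      using that by auto
    ultimately show ?thesis
      using dC(3)[of z "s / T"] that X0 by simp
  qed
  obtain B where "B > 0" and B: "\<And>s v. s \<in> {0..T} \<Longrightarrow> norm (exp_mult (- of_real s) A *v v) \<le> B * norm v"
  proof -
    obtain K where K: "K > 0" "\<And>M v. norm ((M :: complex ^ 'n ^ 'n) *v v) \<le> norm M * norm v * K"
      using bounded_bilinear.pos_bounded[OF bounded_bilinear_matrix_vector_mult] by blast
    have "continuous_on {0..T} (\<lambda>s. exp_mult (- complex_of_real s) A)"
      by (rule continuous_on_compose2[OF exp_mult_continuous[of UNIV]])
        (auto intro!: continuous_intros)
    then have "bounded ((\<lambda>s. exp_mult (- complex_of_real s) A) ` {0..T})"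
      by (intro compact_imp_bounded compact_continuous_image) auto
    then obtain B0 where "B0 > 0"
      and B0: "\<And>s. s \<in> {0..T} \<Longrightarrow> norm (exp_mult (- complex_of_real s) A) \<le> B0"
      unfolding bounded_pos by blast
    show ?thesis
    proof (rule that[of "B0 * K"])
      fix s and v :: "complex ^ 'n" assume "s \<in> {0..T}"
      then have "norm (exp_mult (- complex_of_real s) A) * norm v * K \<le> B0 * norm v * K"
        using B0 K(1) by (intro mult_right_mono) auto
      then show "norm (exp_mult (- of_real s) A *v v) \<le> B0 * K * norm v"
        using K(2)[of "exp_mult (- of_real s) A" v] by (simp add: mult.commute mult.left_commute)
    qed (use \<open>B0 > 0\<close> K in auto)
  qed
  define \<epsilon> where "\<epsilon> = e / (B * C * T + 1)"
  have BCT: "B * C * T \<ge> 0" using \<open>B > 0\<close> dC \<open>T \<ge> 0\<close> by simp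
  then have "\<epsilon> > 0" using \<open>e > 0\<close> by (simp add: \<epsilon>_def add_nonneg_pos)
  from landau_o.smallD[OF small this] obtain d where "d > 0"
    and d: "\<And>z. z \<noteq> 0 \<Longrightarrow> dist z 0 < d \<Longrightarrow> norm (R z) \<le> \<epsilon> * norm z"
    unfolding eventually_at by auto
  have Rd: "norm (R z) \<le> \<epsilon> * norm z" if "norm z < d" for z
    using d[of z] that R0 by (cases "z = 0") auto
  show "\<exists>d>0. \<forall>y. norm (y - 0) < d \<longrightarrow>
      norm (exp_mult (- of_real T) A *v X (of_real T) y - exp_mult (- of_real T) A *v X (of_real T) 0
        - (y - 0)) \<le> e * norm (y - 0)"
  proof (intro exI[of _ "min \<delta> (d / (C + 1))"] conjI allI impI)
    fix y :: "complex ^ 'n" assume y: "norm (y - 0) < min \<delta> (d / (C + 1))"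
    have bound: "norm (exp_mult (- of_real s) A *v R (X (of_real s) y)) \<le> B * (\<epsilon> * (C * norm y))"
      if s: "s \<in> {0..T}" for s
    proof -
      have XCy: "norm (X (of_real s) y) \<le> C * norm y"
        using XC s y by simp
      also have "\<dots> \<le> (C + 1) * norm y"
        by (simp add: mult_right_mono)
      also have "\<dots> < d"
        using y dC by (simp add: pos_less_divide_eq mult.commute)
      finally have "norm (R (X (of_real s) y)) \<le> \<epsilon> * norm (X (of_real s) y)"
        by (rule Rd)
      also have "\<dots> \<le> \<epsilon> * (C * norm y)"
        using XCy \<open>\<epsilon> > 0\<close> by simp
      finally show ?thesis
        using B[OF s, of "R (X (of_real s) y)"] \<open>B > 0\<close>
        by (meson mult_left_mono order.trans less_imp_le)
    qed
    have "norm (\<Phi> y - y) \<le> B * (\<epsilon> * (C * norm y)) * measure lborel {0..T}"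
      unfolding \<Phi>_def
      by (rule has_integral_bound_real[OF _ finite.emptyI twisted_flow_has_integral[OF X R \<open>T \<ge> 0\<close>]])
        (use bound \<open>B > 0\<close> \<open>\<epsilon> > 0\<close> dC in auto)
    also have "\<dots> = (B * C * T) * \<epsilon> * norm y"
      using \<open>T \<ge> 0\<close> by simp
    also have "\<dots> \<le> (B * C * T + 1) * \<epsilon> * norm y"
      using \<open>\<epsilon> > 0\<close> by (intro mult_right_mono) auto
    also have "\<dots> = e * norm y"
      using BCT by (simp add: \<epsilon>_def)
    finally show "norm (exp_mult (- of_real T) A *v X (of_real T) y
        - exp_mult (- of_real T) A *v X (of_real T) 0 - (y - 0)) \<le> e * norm (y - 0)"
      by (simp add: \<Phi>_def X0)
  qed (use \<open>\<delta> > 0\<close> \<open>d > 0\<close> dC in auto)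
qed

text \<open>Differentiating the real-time relation at time \<open>0\<close> gives \<open>DF(z) V(z) = A F(z)\<close>, and this equation
  determines the complex-time behaviour as well.\<close>

lemma conjugacy_complex_time:
  fixes V F :: "complex ^ 'n \<Rightarrow> complex ^ 'n"
  assumes X: "is_complex_flow V X" and "holomorphic_map F"
    and real: "\<And>(s :: real) z. F (X (of_real s) z) = exp_mult (of_real s) A *v F z"
  shows "F (X t z) = exp_mult t A *v F z"
proof -
  obtain D where D: "\<And>z. (F has_derivative (\<lambda>h. D z *v h)) (at z)"
    using holomorphic_map_derivative[OF assms(2)] by blast
  have X0: "X 0 z = z" for z
    using X by (simp add: is_complex_flow_def)
  have dX: "((\<lambda>c. F (X c z)) has_derivative (\<lambda>h. h *s (D (X c z) *v V (X c z)))) (at c)" for c z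
  proof -
    have "((\<lambda>c. X c z) has_derivative (\<lambda>h. h *s V (X c z))) (at c)"
      using X unfolding is_complex_flow_def by blast
    from has_derivative_compose[OF this D] show ?thesis
      by (simp add: matrix_mult_vector_scalar)
  qed
  have eq: "D z *v V z = A *v F z" for z
  proof -
    have of_real: "(complex_of_real has_derivative of_real) (at 0)"
      by (auto intro!: derivative_eq_intros)
    have dX0: "((\<lambda>c. F (X c z)) has_derivative (\<lambda>h. h *s (D z *v V z))) (at (of_real 0))"
      using dX[of z 0] by (simp add: X0)
    have "((\<lambda>c. exp_mult c A *v F z) has_derivative
        (\<lambda>h. map_matrix (\<lambda>a. h * a) (A ** exp_mult 0 A) *v F z)) (at (of_real 0))"
      using bounded_linear.has_derivative[OF bounded_bilinear.bounded_linear_left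
          [OF bounded_bilinear_matrix_vector_mult] exp_mult_has_derivative] by simp
    then have dE0: "((\<lambda>c. exp_mult c A *v F z) has_derivative (\<lambda>h. h *s (A *v F z))) (at (of_real 0))"
      by (simp add: exp_mult_0 matrix_scale_mult_vector)
    have "((\<lambda>s. F (X (of_real s) z)) has_vector_derivative (D z *v V z)) (at (0 :: real))"
      using has_derivative_compose[OF of_real dX0]
      by (simp add: has_vector_derivative_def scaleR_eq_vector_scalar_mult)
    moreover have "((\<lambda>s. F (X (of_real s) z)) has_vector_derivative (A *v F z)) (at (0 :: real))"
      using has_derivative_compose[OF of_real dE0] unfolding real
      by (simp add: has_vector_derivative_def scaleR_eq_vector_scalar_mult)
    ultimately show ?thesis
      by (rule vector_derivative_unique_at)
  qed
  have "((\<lambda>c. exp_mult (- c) A *v F (X c z)) has_derivative (\<lambda>h. 0)) (at c)" for c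
    using exp_mult_curve_has_derivative[OF dX, of A z c] by (simp add: eq)
  then have "exp_mult (- t) A *v F (X t z) = exp_mult (- 0) A *v F (X 0 z)"
    by (intro has_derivative_zero_unique[where s = UNIV and f = "\<lambda>c. exp_mult (- c) A *v F (X c z)"])
      auto
  then have "exp_mult (- t) A *v F (X t z) = F z"
    by (simp add: X0 exp_mult_0)
  then show ?thesis
    using exp_mult_inverse'[of t A "F (X t z)"] by simp
qed

text \<open>Local invertibility at the origin propagates to the whole space along the flow: \<open>F\<close> is injective
  because any two points are carried into the neighbourhood where \<open>F\<close> is, and it is surjective because
  the linear flow contracts.\<close>

lemma conjugacy_attracting_Aut:
  fixes V F :: "complex ^ 'n \<Rightarrow> complex ^ 'n"
  assumes V: "holomorphic_map V" and X: "is_complex_flow V X"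
    and attr: "\<And>z. ((\<lambda>t::real. X (of_real t) z) \<longlongrightarrow> 0) at_top"
    and D: "\<And>z. (F has_derivative (\<lambda>h. D z *v h)) (at z)"
    and "F 0 = 0" and "\<And>h. D 0 *v h = h"
    and conj: "\<And>t z. F (X t z) = exp_mult t A *v F z"
  shows "F \<in> Aut"
proof -
  have hol: "holomorphic_map F" using D by (rule holomorphic_mapI)
  have contF: "continuous_on S F" for S
    using hol by (rule holomorphic_map_continuous)
  define f' where "f' z = Blinfun (\<lambda>h. D z *v h)" for z
  have f': "blinfun_apply (f' z) = (\<lambda>h. D z *v h)" for z
    unfolding f'_def by (simp add: bounded_linear_Blinfun_apply)
  obtain U N g g' where "open U" "0 \<in> U" "open N" "F 0 \<in> N" and hom: "homeomorphism U N F g"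
    and g: "\<And>y. y \<in> N \<Longrightarrow> (g has_derivative g' y) (at y)"
    "\<And>y. y \<in> N \<Longrightarrow> g' y = inv (blinfun_apply (f' (g y)))"
    "\<And>y. y \<in> N \<Longrightarrow> bij (blinfun_apply (f' (g y)))"
  proof (rule inverse_function_theorem[where U = UNIV and f = F and f' = f' and ?x0.0 = 0
        and invf = id_blinfun])
    show "(F has_derivative blinfun_apply (f' x)) (at x)" for x
      using D by (simp add: f')
    show "continuous_on UNIV f'"
      unfolding f'_def by (rule holomorphic_map_derivative_continuous[OF D])
    show "id_blinfun o\<^sub>L f' 0 = id_blinfun"
      by (rule blinfun_eqI) (simp add: f' assms(6))
  qed auto
  have "0 \<in> N" using \<open>F 0 \<in> N\<close> \<open>F 0 = 0\<close> by simp
  have injU: "inj_on F U" and FU: "F ` U = N"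
    and Fg: "\<And>y. y \<in> N \<Longrightarrow> F (g y) = y"
    using hom unfolding homeomorphism_def by (auto intro: inj_on_inverseI)
  have enterU: "\<forall>\<^sub>F t in at_top. X (complex_of_real t) z \<in> U" for z
    using topological_tendstoD[OF attr \<open>open U\<close> \<open>0 \<in> U\<close>] .
  have pull_back: "exp_mult (- t) A *v F u = F (X (- t) u)" for t u
    by (simp add: conj)
  \<comment> \<open>the linear flow contracts, since every vector has a small multiple in the range of \<open>F\<close>\<close>
  have decay: "((\<lambda>t::real. exp_mult (of_real t) A *v w) \<longlongrightarrow> 0) at_top" for w
  proof -
    have "((\<lambda>k::real. k *\<^sub>R w) \<longlongrightarrow> 0 *\<^sub>R w) (at_right 0)"
      by (intro tendsto_intros)
    then have "\<forall>\<^sub>F k in at_right 0. k *\<^sub>R w \<in> N"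
      using topological_tendstoD[of _ 0 _ N] \<open>open N\<close> \<open>0 \<in> N\<close> by simp
    then obtain k :: real where "k > 0" "k *\<^sub>R w \<in> N"
      using eventually_at_right_less[of "0 :: real"]
      by (metis (mono_tags, lifting) eventually_conj eventually_happens' trivial_limit_at_right_real)
    then obtain u where u: "F u = k *\<^sub>R w" using FU by (metis imageE)
    have "((\<lambda>t::real. F (X (of_real t) u)) \<longlongrightarrow> F 0) at_top"
      by (rule continuous_on_tendsto_compose[OF contF[of UNIV] attr]) auto
    then have "((\<lambda>t::real. (1 / k) *\<^sub>R (exp_mult (of_real t) A *v (k *\<^sub>R w))) \<longlongrightarrow> (1 / k) *\<^sub>R 0) at_top"
      unfolding conj u \<open>F 0 = 0\<close> by (intro tendsto_intros)
    then show ?thesis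
      using \<open>k > 0\<close> by (simp add: linear_scale[OF matrix_vector_mul_linear])
  qed
  have enterN: "\<exists>t::real. exp_mult (of_real t) A *v w \<in> N" for w
    using topological_tendstoD[OF decay \<open>open N\<close> \<open>0 \<in> N\<close>, of w]
    by (metis (mono_tags, lifting) eventually_happens' trivial_limit_at_top_linorder)
  have "inj F"
  proof (rule injI)
    fix a b assume "F a = F b"
    have "\<forall>\<^sub>F t in at_top. X (complex_of_real t) a \<in> U \<and> X (complex_of_real t) b \<in> U"
      using enterU enterU by (rule eventually_conj)
    then obtain t :: real where "X (of_real t) a \<in> U" "X (of_real t) b \<in> U"
      by (metis (mono_tags, lifting) eventually_happens' trivial_limit_at_top_linorder)
    moreover have "F (X (of_real t) a) = F (X (of_real t) b)"
      using \<open>F a = F b\<close> by (simp add: conj)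
    ultimately have "X (of_real t) a = X (of_real t) b"
      using injU by (simp add: inj_on_def)
    then show "a = b"
      using flow_inverse[OF V X, of "- of_real t"] by (metis minus_minus)
  qed
  moreover have pre: "F (X (- of_real t) (g (exp_mult (of_real t) A *v w))) = w"
    if "exp_mult (of_real t) A *v w \<in> N" for w and t :: real
    using Fg[OF that] exp_mult_inverse[of "of_real t" A w] by (simp add: pull_back[symmetric])
  then have "surj F"
    using enterN by (metis surjI surj_def)
  ultimately have "bij F" by (simp add: bij_def)
  have "\<exists>D. (inv F has_derivative (\<lambda>h. D *v h)) (at w)" for w
  proof -
    obtain t :: real where t: "exp_mult (of_real t) A *v w \<in> N" using enterN by blast
    define y where "y = exp_mult (of_real t) A *v w"
    have "y \<in> N" using t by (simp add: y_def)
    have bij: "bij (\<lambda>h. D (g y) *v h)" and g'y: "g' y = inv (\<lambda>h. D (g y) *v h)"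
      using g[OF \<open>y \<in> N\<close>] by (simp_all add: f')
    have "g' y (c *s v) = c *s g' y v" for c v
    proof -
      have "D (g y) *v (c *s g' y v) = c *s v"
        unfolding matrix_mult_vector_scalar g'y using surj_f_inv_f[OF bij_is_surj[OF bij]] by simp
      then show ?thesis
        unfolding g'y using bij bij_inv_eq_iff by metis
    qed
    moreover have "linear (g' y)"
      using g(1)[OF \<open>y \<in> N\<close>] has_derivative_linear by blast
    ultimately have "g' y = (*v) (matrix (g' y))"
      using complex_linear_matrix by blast
    then obtain G where dg: "(g has_derivative (\<lambda>h. G *v h)) (at y)"
      using g(1)[OF \<open>y \<in> N\<close>] by metis
    obtain P where dX: "\<And>z. (X (- of_real t) has_derivative (\<lambda>h. P z *v h)) (at z)"
      using holomorphic_map_derivative[OF flow_holomorphic[OF V X]] by blast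
    have dE: "((\<lambda>w. exp_mult (of_real t) A *v w) has_derivative (\<lambda>h. exp_mult (of_real t) A *v h)) (at w)"
      by (simp add: bounded_linear_imp_has_derivative)
    have deriv: "((\<lambda>w. X (- of_real t) (g (exp_mult (of_real t) A *v w))) has_derivative
        (\<lambda>h. P (g y) *v (G *v (exp_mult (of_real t) A *v h)))) (at w)"
      using has_derivative_compose[OF has_derivative_compose[OF dE dg[unfolded y_def]] dX]
      by (simp add: y_def)
    have opn: "open {w. exp_mult (of_real t) A *v w \<in> N}"
      using open_vimage[OF \<open>open N\<close> matrix_vector_mult_linear_continuous_on[of UNIV]]
      by (simp add: vimage_def)
    have eq: "X (- of_real t) (g (exp_mult (of_real t) A *v w')) = inv F w'"
      if "exp_mult (of_real t) A *v w' \<in> N" for w'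
      using pre[OF that] \<open>inj F\<close> by (metis inv_f_f)
    have "(inv F has_derivative (\<lambda>h. P (g y) *v (G *v (exp_mult (of_real t) A *v h)))) (at w)"
      by (rule has_derivative_transform_within_open[OF deriv opn]) (use t eq in auto)
    then show ?thesis
      unfolding matrix_vector_mul_assoc by blast
  qed
  then have "holomorphic_map (inv F)"
    unfolding holomorphic_map_def by blast
  with \<open>bij F\<close> hol show ?thesis by (simp add: Aut_def)
qed

theorem theorem1p7:
  fixes V R :: "complex ^ 'n \<Rightarrow> complex ^ 'n"
    and X :: "complex \<Rightarrow> complex ^ 'n \<Rightarrow> complex ^ 'n"
    and A :: "complex ^ 'n ^ 'n"
  assumes "holomorphic_map V"
    and "complete_field V"
    and "is_complex_flow V X"
    and "globally_asymptotically_stable_origin V X"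
    and "(V has_derivative (\<lambda>h. A *v h)) (at 0)"
    and "\<And>z. V z = A *v z + R z"
    and "(\<lambda>z. norm (R z)) \<in> o[at 0](\<lambda>z. norm z)"
    and "\<And>K. compact K \<Longrightarrow>
           improper_integral_converges_uniformly_on K
             (\<lambda>s z. exp_mult (- of_real s) A *v R (X (of_real s) z))"
  shows "\<exists>F. locally_uniform_limit (\<lambda>(t::real) z. exp_mult (- of_real t) A *v X (of_real t) z) F at_top
           \<and> F \<in> Aut
           \<and> (\<forall>t::complex. F \<circ> X t \<circ> inv F = (\<lambda>w. exp_mult t A *v w))"
proof -
  note V = assms(1) and X = assms(3) and R = assms(6)
  have V0: "V 0 = 0" and attr: "\<And>z. ((\<lambda>t::real. X (of_real t) z) \<longlongrightarrow> 0) at_top"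
    using assms(4) by (auto simp: globally_asymptotically_stable_origin_def)
  define \<Phi> where "\<Phi> t z = exp_mult (- of_real t) A *v X (of_real t) z" for t :: real and z
  have limK: "\<exists>I. uniform_limit K \<Phi> I at_top" if K: "compact K" for K
  proof -
    obtain I where "uniform_limit K
        (\<lambda>T z. integral {0..T} (\<lambda>s. exp_mult (- of_real s) A *v R (X (of_real s) z))) I at_top"
      using assms(8)[OF K] unfolding improper_integral_converges_uniformly_on_def by blast
    then have "uniform_limit K
        (\<lambda>T z. z + integral {0..T} (\<lambda>s. exp_mult (- of_real s) A *v R (X (of_real s) z)))
        (\<lambda>z. z + I z) at_top"
      by (intro uniform_limit_add uniform_limit_const)
    moreover have "\<forall>\<^sub>F T in at_top. \<forall>z\<in>K.
        z + integral {0..T} (\<lambda>s. exp_mult (- of_real s) A *v R (X (of_real s) z)) = \<Phi> T z"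
      using eventually_ge_at_top[of 0]
    proof eventually_elim
      case (elim T)
      show ?case
        unfolding \<Phi>_def integral_unique[OF twisted_flow_has_integral[OF X R elim]] by simp
    qed
    ultimately have "uniform_limit K \<Phi> (\<lambda>z. z + I z) at_top"
      by (subst (asm) uniform_limit_cong) auto
    then show ?thesis by blast
  qed
  have "\<exists>l. ((\<lambda>t. \<Phi> t z) \<longlongrightarrow> l) at_top" for z
  proof -
    obtain I where "uniform_limit {z} \<Phi> I at_top" using limK[of "{z}"] by auto
    from tendsto_uniform_limitI[OF this, of z] show ?thesis by blast
  qed
  then obtain F where F: "\<And>z. ((\<lambda>t. \<Phi> t z) \<longlongrightarrow> F z) at_top" by metis
  have limF: "uniform_limit K \<Phi> F at_top" if K: "compact K" for K
  proof -
    obtain I where I: "uniform_limit K \<Phi> I at_top" using limK[OF K] by blast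
    have IF: "I z = F z" if "z \<in> K" for z
      using tendsto_uniform_limitI[OF I that] F by (rule tendsto_unique[rotated]) simp
    show ?thesis using I by (subst (asm) uniform_limit_cong'[OF refl IF]) auto
  qed
  have "locally_uniform_limit \<Phi> F at_top"
    unfolding locally_uniform_limit_def
  proof
    fix z
    have "uniform_limit (ball z 1) \<Phi> F at_top"
      by (rule uniform_limit_on_subset[OF limF[of "cball z 1"]]) auto
    then show "\<exists>U. open U \<and> z \<in> U \<and> uniform_limit U \<Phi> F at_top"
      by (intro exI[of _ "ball z 1"]) simp
  qed
  have "holomorphic_map (\<Phi> t)" for t
    unfolding \<Phi>_def
    by (intro holomorphic_map_compose[OF holomorphic_map_linear flow_holomorphic[OF V X]])
  then have "holomorphic_map (\<Phi> (real n))" for n .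
  then obtain D\<^sub>n where Dn: "\<And>n z. (\<Phi> (real n) has_derivative (\<lambda>h. D\<^sub>n n z *v h)) (at z)"
    by (rule holomorphic_map_family_derivative[of "\<lambda>n. \<Phi> (real n)"]) (erule that)
  have "\<exists>r>0. uniform_limit (cball z r) (\<lambda>n. \<Phi> (real n)) F sequentially" for z
    using filterlim_compose[OF limF[of "cball z 1"] filterlim_real_sequentially]
    by (intro exI[of _ 1]) simp
  then have "\<exists>D. \<forall>z. (F has_derivative (\<lambda>h. D z *v h)) (at z) \<and>
      (\<forall>h. (\<lambda>n. D\<^sub>n n z *v h) \<longlonglongrightarrow> D z *v h)"
    by (rule holomorphic_map_limit[OF Dn])
  then obtain D where D': "\<forall>z. (F has_derivative (\<lambda>h. D z *v h)) (at z) \<and>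
      (\<forall>h. (\<lambda>n. D\<^sub>n n z *v h) \<longlonglongrightarrow> D z *v h)"
    by (rule exE)
  have D: "(F has_derivative (\<lambda>h. D z *v h)) (at z)"
    and Dlim: "(\<lambda>n. D\<^sub>n n z *v h) \<longlonglongrightarrow> D z *v h" for z h
    using D' by blast+
  have D0: "D 0 *v h = h" for h
  proof -
    have "(\<lambda>h. D\<^sub>n n 0 *v h) = (\<lambda>h. h)" for n
      using has_derivative_unique[OF Dn twisted_flow_derivative_at_origin[OF V X V0 R assms(7),
            of "real n", folded \<Phi>_def]] by simp
    then have "D\<^sub>n n 0 *v h = h" for n by meson
    then show ?thesis
      using Dlim[of 0 h] by (simp add: LIMSEQ_const_iff)
  qed
  have F0: "F 0 = 0"
  proof -
    have "\<Phi> t 0 = 0" for t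
      by (simp add: \<Phi>_def flow_fixed_point[OF V X V0])
    then show ?thesis
      using F[of 0] by (simp add: tendsto_const_iff)
  qed
  have "F (X (of_real s) z) = exp_mult (of_real s) A *v F z" for s :: real and z
  proof -
    have "\<Phi> t (X (of_real s) z) = exp_mult (of_real s) A *v \<Phi> (s + t) z" for t
      using exp_mult_uminus_add[of "- of_real s" A "- of_real t"]
      by (simp add: \<Phi>_def flow_add[OF V X] matrix_vector_mul_assoc)
    moreover have "((\<lambda>t. exp_mult (of_real s) A *v \<Phi> (s + t) z) \<longlongrightarrow> exp_mult (of_real s) A *v F z) at_top"
      by (intro bounded_linear.tendsto[OF matrix_vector_mul_bounded_linear]
          filterlim_compose[OF F] filterlim_tendsto_add_at_top[OF tendsto_const filterlim_ident])
    ultimately have "((\<lambda>t. \<Phi> t (X (of_real s) z)) \<longlongrightarrow> exp_mult (of_real s) A *v F z) at_top"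
      by simp
    with F show ?thesis
      by (rule tendsto_unique[rotated]) simp
  qed
  from conjugacy_complex_time[OF X holomorphic_mapI[OF D] this]
  have conj: "F (X t z) = exp_mult t A *v F z" for t z .
  have "F \<in> Aut"
    by (rule conjugacy_attracting_Aut[OF V X attr D F0 D0 conj])
  moreover have "F \<circ> X t \<circ> inv F = (\<lambda>w. exp_mult t A *v w)" for t
    using \<open>F \<in> Aut\<close> by (simp add: fun_eq_iff conj Aut_def bij_is_surj surj_f_inv_f)
  ultimately show ?thesis
    using \<open>locally_uniform_limit \<Phi> F at_top\<close> unfolding \<Phi>_def by blast
qed

end
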